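(* Let $d\ge2$, let $X=(X_1,\dots,X_d)$ be a random vector with components $X_j\in\mathbb{R}^{p_j}$, $p=\sum_{j=1}^dp_j$, and let $X^1,X^2,\dots$ be i.i.d. with the distribution of $X$; for each $n$ put $\mathbf{X}=\{X^1,\dots,X^n\}$. If $\mathrm{E}|X|<\infty$, then almost surely, as $n\to\infty$, $$\mathcal{Q}_n(\mathbf{X})\to\mathcal{Q}(X)\qquad\text{and}\qquad \mathcal{Q}_n^\star(\mathbf{X})\to\mathcal{Q}(X).$$
   Context: Each component $X_j$ is a continuous random vector in $\mathbb{R}^{p_j}$ (its distribution is absolutely continuous with respect to Lebesgue measure). $|\cdot|$ is the Euclidean norm (modulus for complex numbers), $\langle\cdot,\cdot\rangle$ the Euclidean inner product. Write $X^k=(X_1^k,\dots,X_d^k)$ with $X_j^k\in\mathbb{R}^{p_j}$. For fixed $n$, upper indices are taken cyclically: $X_j^{n+k}$ is interpreted as $X_j^k$ for $k>0$. For $t=(t_1,\dots,t_d)\in\mathbb{R}^p$, $t_j\in\mathbb{R}^{p_j}$, define $\phi_X(t)=\mathrm{E}[e^{i\langle t,X\rangle}]$, $\phi_{\widetilde X}(t)=\prod_{j=1}^d\mathrm{E}[e^{i\langle t_j,X_j\rangle}]$, and the empirical versions $$\phi_X^n(t)=\frac1n\sum_{k=1}^ne^{i\langle t,X^k\rangle},\quad \phi^n_{\widetilde X}(t)=\prod_{j=1}^d\Big(\frac1n\sum_{k=1}^ne^{i\langle t_j,X_j^k\rangle}\Big),\quad \phi^{n\star}_{\widetilde X}(t)=\frac1n\sum_{k=1}^ne^{i\sum_{j=1}^d\langle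 t_j,X_j^{k+j-1}\rangle}.$$ The weight function is $w_1(t)=(K_p|t|^{p+1})^{-1}$ with $K_q=\frac{\pi^{(q+1)/2}}{\Gamma((q+1)/2)}$, and $\|\eta\|_{w_1}^2=\int_{\mathbb{R}^p}|\eta(t)|^2w_1(t)\,dt$. Then $\mathcal{Q}(X)=\|\phi_X-\phi_{\widetilde X}\|_{w_1}^2$, $\mathcal{Q}_n(\mathbf{X})=\|\phi_X^n-\phi^n_{\widetilde X}\|_{w_1}^2$, and $\mathcal{Q}^\star_n(\mathbf{X})=\|\phi_X^n-\phi^{n\star}_{\widetilde X}\|_{w_1}^2$. *)

theory Defs
  imports "HOL-Probability.Probability"
begin

text \<open>
  A decomposition of \<open>\<real>\<^sup>p\<close> into blocks of dimensions \<open>p\<^sub>1, \<dots>, p\<^sub>d\<close> is given by a labelling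
  \<open>b :: 'n \<Rightarrow> nat\<close> of the coordinates with \<open>range b = {1..d}\<close>: the \<open>j\<close>-th component of
  \<open>x :: real ^ 'n\<close> consists of the coordinates \<open>x $ i\<close> with \<open>b i = j\<close>. Thus \<open>p = CARD('n)\<close> and
  \<open>p\<^sub>j = card (block b j)\<close>, which is positive for \<open>j \<in> {1..d}\<close>.
\<close>

definition block :: "('n::finite \<Rightarrow> nat) \<Rightarrow> nat \<Rightarrow> 'n set" where
  "block b j = {i. b i = j}"

definition block_inner :: "('n::finite \<Rightarrow> nat) \<Rightarrow> nat \<Rightarrow> real ^ 'n \<Rightarrow> real ^ 'n \<Rightarrow> real" where
  "block_inner b j t x = (\<Sum>i\<in>block b j. t $ i * x $ i)"

definition component :: "('n::finite \<Rightarrow> nat) \<Rightarrow> nat \<Rightarrow> real ^ 'n \<Rightarrow> ('n \<Rightarrow> real)" where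
  "component b j x = restrict (\<lambda>i. x $ i) (block b j)"

definition block_lborel :: "('n::finite \<Rightarrow> nat) \<Rightarrow> nat \<Rightarrow> ('n \<Rightarrow> real) measure" where
  "block_lborel b j = Pi\<^sub>M (block b j) (\<lambda>_. lborel)"

definition char_joint :: "'a measure \<Rightarrow> ('a \<Rightarrow> real ^ 'n) \<Rightarrow> real ^ 'n::finite \<Rightarrow> complex" where
  "char_joint M X t = (LINT \<omega>|M. iexp (t \<bullet> X \<omega>))"

definition char_prod ::
  "('n::finite \<Rightarrow> nat) \<Rightarrow> nat \<Rightarrow> 'a measure \<Rightarrow> ('a \<Rightarrow> real ^ 'n) \<Rightarrow> real ^ 'n \<Rightarrow> complex" where
  "char_prod b d M X t = (\<Prod>j=1..d. LINT \<omega>|M. iexp (block_inner b j t (X \<omega>)))"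

text \<open>A sample of size \<open>n\<close> consists of \<open>x 1, \<dots>, x n\<close>; the value \<open>x 0\<close> is never used.\<close>

definition emp_char :: "nat \<Rightarrow> (nat \<Rightarrow> real ^ 'n) \<Rightarrow> real ^ 'n::finite \<Rightarrow> complex" where
  "emp_char n x t = (1 / of_nat n) * (\<Sum>k=1..n. iexp (t \<bullet> x k))"

definition emp_char_prod ::
  "('n::finite \<Rightarrow> nat) \<Rightarrow> nat \<Rightarrow> nat \<Rightarrow> (nat \<Rightarrow> real ^ 'n) \<Rightarrow> real ^ 'n \<Rightarrow> complex" where
  "emp_char_prod b d n x t =
     (\<Prod>j=1..d. (1 / of_nat n) * (\<Sum>k=1..n. iexp (block_inner b j t (x k))))"

text \<open>
  Reduction of a positive index modulo \<open>n\<close> to the representative in \<open>{1..n}\<close>, so that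
  \<open>cyc n (n + k) = cyc n k\<close> for \<open>k > 0\<close>.
\<close>

definition cyc :: "nat \<Rightarrow> nat \<Rightarrow> nat" where
  "cyc n m = (m - 1) mod n + 1"

definition emp_char_star ::
  "('n::finite \<Rightarrow> nat) \<Rightarrow> nat \<Rightarrow> nat \<Rightarrow> (nat \<Rightarrow> real ^ 'n) \<Rightarrow> real ^ 'n \<Rightarrow> complex" where
  "emp_char_star b d n x t =
     (1 / of_nat n) *
     (\<Sum>k=1..n. iexp (\<Sum>j=1..d. block_inner b j t (x (cyc n (k + j - 1)))))"

definition K :: "nat \<Rightarrow> real" where
  "K q = pi powr ((real q + 1) / 2) / Gamma ((real q + 1) / 2)"

definition w1 :: "real ^ 'n::finite \<Rightarrow> real" where
  "w1 t = 1 / (K CARD('n) * norm t ^ (CARD('n) + 1))"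

text \<open>
  The squared weighted norm takes values in \<open>[0, \<infinity>]\<close>, so no convention for divergent
  integrals enters.
\<close>

definition wnorm2 :: "(real ^ 'n::finite \<Rightarrow> complex) \<Rightarrow> ennreal" where
  "wnorm2 \<eta> = (\<integral>\<^sup>+ t. ennreal ((cmod (\<eta> t))\<^sup>2 * w1 t) \<partial>lborel)"

definition Q ::
  "('n::finite \<Rightarrow> nat) \<Rightarrow> nat \<Rightarrow> 'a measure \<Rightarrow> ('a \<Rightarrow> real ^ 'n) \<Rightarrow> ennreal" where
  "Q b d M X = wnorm2 (\<lambda>t. char_joint M X t - char_prod b d M X t)"

definition Q_emp :: "('n::finite \<Rightarrow> nat) \<Rightarrow> nat \<Rightarrow> nat \<Rightarrow> (nat \<Rightarrow> real ^ 'n) \<Rightarrow> ennreal" where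
  "Q_emp b d n x = wnorm2 (\<lambda>t. emp_char n x t - emp_char_prod b d n x t)"

definition Q_star :: "('n::finite \<Rightarrow> nat) \<Rightarrow> nat \<Rightarrow> nat \<Rightarrow> (nat \<Rightarrow> real ^ 'n) \<Rightarrow> ennreal" where
  "Q_star b d n x = wnorm2 (\<lambda>t. emp_char n x t - emp_char_star b d n x t)"

end

theory Submission
  imports Defs "HOL-Library.Discrete_Functions"
begin

text \<open>
  Both statements follow from dominated convergence in the integral defining the weighted norm.
  For each fixed \<open>t\<close> the empirical characteristic functions are averages of bounded variables that
  are independent at distance at least \<open>d\<close>, so a second moment bound along the squares gives almost
  sure convergence; Fubini's theorem makes this hold almost surely for almost every \<open>t\<close>.
  For the domination, all empirical characteristic functions differ from \<open>1\<close> by at most a multiple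
  of \<open>norm t\<close> times the sample mean of \<open>norm X\<close>. Those means are almost surely bounded because
  \<open>E (norm X)\<close> is finite, so the integrand is dominated by a multiple of \<open>min 1 (norm t)\<^sup>2 * w1 t\<close>,
  which is integrable.
\<close>

subsection \<open>A strong law for bounded variables of finite-range dependence\<close>

text \<open>The weight behaves like \<open>1 / norm t ^ (p + 1)\<close> at 0 and is not integrable
  there, so boundedness of the characteristic functions cannot dominate: a factor
  \<open>norm t\<close> has to be gained uniformly in \<open>n\<close>, and this is where the first
  moment enters. For that purpose the sample means have to stay bounded, not to converge, so dyadic
  sample sizes suffice and monotonicity of the sums fills the gaps. The limits at a fixed
  \<open>t\<close> concern bounded variables only. The summands of the starred version mix
  consecutive sample points and are not independent, but windows starting at least \<open>d\<close>
  apart share no sample point, so they are uncorrelated and second moments of sums grow linearly.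
  The null set of the limit at \<open>t\<close> depends on \<open>t\<close>, and uncountably many
  such sets cannot be united; since the norm is an integral, almost every \<open>t\<close> is
  enough.\<close>

lemma AE_tendsto_zero_of_summable_integral:
  fixes Y :: "nat \<Rightarrow> 'a \<Rightarrow> real"
  assumes int: "\<And>n. integrable M (Y n)" and nonneg: "\<And>n x. 0 \<le> Y n x"
    and sm: "summable (\<lambda>n. LINT x|M. Y n x)"
  shows "AE x in M. (\<lambda>n. Y n x) \<longlonglongrightarrow> 0"
proof -
  note [measurable] = borel_measurable_integrable[OF int]
  have "(\<integral>\<^sup>+x. (\<Sum>n. ennreal (Y n x)) \<partial>M) = (\<Sum>n. \<integral>\<^sup>+x. ennreal (Y n x) \<partial>M)"
    by (rule nn_integral_suminf) simp
  also have "\<dots> = (\<Sum>n. ennreal (LINT x|M. Y n x))"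
    by (simp add: nn_integral_eq_integral int nonneg)
  also have "\<dots> \<noteq> \<infinity>"
    using sm by (simp add: ennreal_suminf_neq_top integral_nonneg nonneg)
  \<comment> \<open>A finite integral forces the sum to be finite almost everywhere, and the terms
    of a convergent series vanish. This takes the place of Markov's inequality with the
    Borel-Cantelli lemma.\<close>
  finally have "AE x in M. (\<Sum>n. ennreal (Y n x)) \<noteq> \<infinity>"
    by (intro nn_integral_PInf_AE) auto
  then show ?thesis
    by eventually_elim
      (auto intro!: summable_LIMSEQ_zero summable_suminf_not_top simp: nonneg)
qed

text \<open>Expanding the square leaves, for each \<open>k\<close>, at most \<open>2 * d\<close>
  indices \<open>l\<close> at distance below \<open>d\<close>, and each such term is at most
  \<open>B\<close> by the arithmetic-geometric mean inequality. The real inner product lets one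
  statement serve complex products with range \<open>d\<close> and real truncations with range
  1.\<close>

lemma (in prob_space) second_moment_sum_le:
  fixes U :: "nat \<Rightarrow> 'a \<Rightarrow> 'b :: euclidean_space"
  assumes A: "finite A"
    and [measurable]: "\<And>k. k \<in> A \<Longrightarrow> U k \<in> borel_measurable M"
    and int: "\<And>k. k \<in> A \<Longrightarrow> integrable M (\<lambda>\<omega>. (norm (U k \<omega>))\<^sup>2)"
    and bound: "\<And>k. k \<in> A \<Longrightarrow> expectation (\<lambda>\<omega>. (norm (U k \<omega>))\<^sup>2) \<le> B"
    and orth: "\<And>k l. k \<in> A \<Longrightarrow> l \<in> A \<Longrightarrow> k + d \<le> l \<Longrightarrow> expectation (\<lambda>\<omega>. U k \<omega> \<bullet> U l \<omega>) = 0"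
  shows "integrable M (\<lambda>\<omega>. (norm (\<Sum>k\<in>A. U k \<omega>))\<^sup>2)"
    and "expectation (\<lambda>\<omega>. (norm (\<Sum>k\<in>A. U k \<omega>))\<^sup>2) \<le> 2 * real d * B * real (card A)"
proof -
  have amgm: "\<bar>x \<bullet> y\<bar> \<le> ((norm x)\<^sup>2 + (norm y)\<^sup>2) / 2" for x y :: 'b
  proof -
    have "\<bar>x \<bullet> y\<bar> \<le> norm x * norm y" by (rule Cauchy_Schwarz_ineq2)
    also have "\<dots> \<le> ((norm x)\<^sup>2 + (norm y)\<^sup>2) / 2"
      using sum_squares_bound[of "norm x" "norm y"] by simp
    finally show ?thesis .
  qed
  have int_inner: "integrable M (\<lambda>\<omega>. U k \<omega> \<bullet> U l \<omega>)" if "k \<in> A" "l \<in> A" for k l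
  proof (rule Bochner_Integration.integrable_bound)
    show "integrable M (\<lambda>\<omega>. ((norm (U k \<omega>))\<^sup>2 + (norm (U l \<omega>))\<^sup>2) / 2)"
      using that by (auto intro!: int)
    show "AE \<omega> in M. norm (U k \<omega> \<bullet> U l \<omega>) \<le> norm (((norm (U k \<omega>))\<^sup>2 + (norm (U l \<omega>))\<^sup>2) / 2)"
      by (rule AE_I2) (metis amgm real_norm_def abs_ge_self order_trans)
  qed (use that in simp)
  have expand: "(norm (\<Sum>k\<in>A. U k \<omega>))\<^sup>2 = (\<Sum>k\<in>A. \<Sum>l\<in>A. U k \<omega> \<bullet> U l \<omega>)" for \<omega>
    by (simp add: power2_norm_eq_inner inner_sum_left inner_sum_right)
      (rule sum.swap)
  show "integrable M (\<lambda>\<omega>. (norm (\<Sum>k\<in>A. U k \<omega>))\<^sup>2)"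
    unfolding expand by (intro Bochner_Integration.integrable_sum int_inner)
  have pair: "expectation (\<lambda>\<omega>. U k \<omega> \<bullet> U l \<omega>) \<le> (if k < l + d \<and> l < k + d then B else 0)"
    if kl: "k \<in> A" "l \<in> A" for k l
  proof (cases "k < l + d \<and> l < k + d")
    case True
    have "expectation (\<lambda>\<omega>. U k \<omega> \<bullet> U l \<omega>) \<le> expectation (\<lambda>\<omega>. ((norm (U k \<omega>))\<^sup>2 + (norm (U l \<omega>))\<^sup>2) / 2)"
      by (intro integral_mono int_inner kl Bochner_Integration.integrable_divide
          Bochner_Integration.integrable_add int) (use amgm abs_le_D1 in blast)
    also have "\<dots> \<le> B"
      using bound[OF kl(1)] bound[OF kl(2)] by (simp add: int kl)
    finally show ?thesis using True by simp
  next
    case False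
    then show ?thesis using orth[of k l] orth[of l k] kl by (auto simp: inner_commute)
  qed
  have "expectation (\<lambda>\<omega>. (norm (\<Sum>k\<in>A. U k \<omega>))\<^sup>2)
      = (\<Sum>k\<in>A. \<Sum>l\<in>A. expectation (\<lambda>\<omega>. U k \<omega> \<bullet> U l \<omega>))"
    unfolding expand by (simp add: Bochner_Integration.integral_sum int_inner)
  also have "\<dots> \<le> (\<Sum>k\<in>A. 2 * real d * B)"
  proof (rule sum_mono)
    fix k assume k: "k \<in> A"
    have "0 \<le> expectation (\<lambda>\<omega>. (norm (U k \<omega>))\<^sup>2)" by simp
    then have B: "0 \<le> B" using bound[OF k] by linarith
    have "(\<Sum>l\<in>A. expectation (\<lambda>\<omega>. U k \<omega> \<bullet> U l \<omega>)) \<le> (\<Sum>l\<in>A. if k < l + d \<and> l < k + d then B else 0)"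
      by (intro sum_mono pair k)
    also have "\<dots> = real (card {l\<in>A. k < l + d \<and> l < k + d}) * B"
      using A by (simp add: sum.If_cases Int_def)
    also have "\<dots> \<le> real (card {k + 1 - d..<k + d}) * B"
      using B by (intro mult_right_mono of_nat_mono card_mono) auto
    also have "\<dots> \<le> real (2 * d) * B"
      using B by (intro mult_right_mono of_nat_mono) auto
    finally show "(\<Sum>l\<in>A. expectation (\<lambda>\<omega>. U k \<omega> \<bullet> U l \<omega>)) \<le> 2 * real d * B" by simp
  qed
  finally show "expectation (\<lambda>\<omega>. (norm (\<Sum>k\<in>A. U k \<omega>))\<^sup>2) \<le> 2 * real d * B * real (card A)"
    by (simp add: mult_ac)
qed

text \<open>Along \<open>n = q\<^sup>2\<close> the normalized second moments are at most
  \<open>C / q\<^sup>2\<close>, hence summable, while the gap to the next square holds at most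
  \<open>2 * q\<close> bounded terms, negligible against \<open>q\<^sup>2\<close>. Dependence
  between the variables enters only through the growth of the second moments.\<close>

lemma (in prob_space) bounded_strong_law:
  fixes V :: "nat \<Rightarrow> 'a \<Rightarrow> 'b :: euclidean_space"
  assumes bounded: "\<And>k \<omega>. k \<ge> 1 \<Longrightarrow> norm (V k \<omega>) \<le> B"
    and int: "\<And>n. integrable M (\<lambda>\<omega>. (norm (\<Sum>k=1..n. V k \<omega>))\<^sup>2)"
    and moment: "\<And>n. expectation (\<lambda>\<omega>. (norm (\<Sum>k=1..n. V k \<omega>))\<^sup>2) \<le> C * real n"
  shows "AE \<omega> in M. (\<lambda>n. (\<Sum>k=1..n. V k \<omega>) /\<^sub>R real n) \<longlonglongrightarrow> 0"
proof -
  define S where "S n \<omega> = (\<Sum>k=1..n. V k \<omega>)" for n \<omega>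
  have B: "0 \<le> B" using bounded[of 1] norm_ge_zero order_trans by blast
  have "AE \<omega> in M. (\<lambda>q. (norm (S (q\<^sup>2) \<omega>))\<^sup>2 / real q ^ 4) \<longlonglongrightarrow> 0"
  proof (rule AE_tendsto_zero_of_summable_integral)
    show "summable (\<lambda>q. LINT \<omega>|M. (norm (S (q\<^sup>2) \<omega>))\<^sup>2 / real q ^ 4)"
    proof (rule summable_comparison_test')
      show "summable (\<lambda>q. C * (1 / real q ^ 2))"
        using inverse_power_summable[of 2, where 'a=real] by (intro summable_mult) (simp add: field_simps)
      show "norm (LINT \<omega>|M. (norm (S (q\<^sup>2) \<omega>))\<^sup>2 / real q ^ 4) \<le> C * (1 / real q ^ 2)" for q
      proof -
        have "norm (LINT \<omega>|M. (norm (S (q\<^sup>2) \<omega>))\<^sup>2 / real q ^ 4)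
            = (LINT \<omega>|M. (norm (S (q\<^sup>2) \<omega>))\<^sup>2) / real q ^ 4" by simp
        also have "\<dots> \<le> C * real (q\<^sup>2) / real q ^ 4"
          using moment[of "q\<^sup>2"] by (intro divide_right_mono) (auto simp: S_def)
        \<comment> \<open>At \<open>q = 0\<close> division by zero gives 0 on both sides.\<close>
        also have "\<dots> = C * (1 / real q ^ 2)"
          by (cases "q = 0") (auto simp: field_simps power2_eq_square power4_eq_xxxx)
        finally show ?thesis .
      qed
    qed
  qed (use int in \<open>auto simp: S_def\<close>)
  then show ?thesis
  proof eventually_elim
    case (elim \<omega>)
    have "(\<lambda>q. sqrt ((norm (S (q\<^sup>2) \<omega>))\<^sup>2 / real q ^ 4)) \<longlonglongrightarrow> sqrt 0"
      by (intro tendsto_real_sqrt elim)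
    moreover have "sqrt ((norm (S (q\<^sup>2) \<omega>))\<^sup>2 / real q ^ 4) = norm (S (q\<^sup>2) \<omega>) / real q ^ 2" for q
    proof -
      have "(norm (S (q\<^sup>2) \<omega>))\<^sup>2 / real q ^ 4 = (norm (S (q\<^sup>2) \<omega>) / real q ^ 2)\<^sup>2"
        by (simp add: power_divide)
      then show ?thesis by simp
    qed
    ultimately have sq: "(\<lambda>q. norm (S (q\<^sup>2) \<omega>) / real q ^ 2) \<longlonglongrightarrow> 0" by simp
    have fl: "filterlim floor_sqrt at_top at_top"
      unfolding filterlim_at_top
    proof
      fix Z
      show "\<forall>\<^sub>F x in at_top. Z \<le> floor_sqrt x"
        using eventually_ge_at_top[of "Z\<^sup>2"]
        by eventually_elim (metis mono_floor_sqrt' floor_sqrt_inverse_power2)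
    qed
    have lim: "(\<lambda>q. norm (S (q\<^sup>2) \<omega>) / real q ^ 2 + 2 * B / real q) \<longlonglongrightarrow> 0"
      using tendsto_add[OF sq lim_const_over_n[of "2 * B"]] by simp
    have "(\<lambda>n. S n \<omega> /\<^sub>R real n) \<longlonglongrightarrow> 0"
    proof (rule Lim_null_comparison[OF _ filterlim_compose[OF lim fl]])
      show "\<forall>\<^sub>F n in sequentially. norm (S n \<omega> /\<^sub>R real n)
          \<le> norm (S ((floor_sqrt n)\<^sup>2) \<omega>) / real (floor_sqrt n) ^ 2 + 2 * B / real (floor_sqrt n)"
        using eventually_gt_at_top[of 0]
      proof eventually_elim
        case (elim n)
        define q where "q = floor_sqrt n"
        have q: "q\<^sup>2 \<le> n" "n < (Suc q)\<^sup>2" "0 < q"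
          using elim Suc_floor_sqrt_power2_gt[of n] by (auto simp: q_def)
        have "S n \<omega> = S (q\<^sup>2) \<omega> + (\<Sum>k\<in>{q\<^sup>2<..n}. V k \<omega>)"
          unfolding S_def using q(1)
          by (subst sum.union_disjoint[symmetric]) (auto intro!: sum.cong)
        moreover have "norm (\<Sum>k\<in>{q\<^sup>2<..n}. V k \<omega>) \<le> real (n - q\<^sup>2) * B"
          using sum_norm_bound[of "{q\<^sup>2<..n}" "\<lambda>k. V k \<omega>" B] bounded by simp
        \<comment> \<open>\<open>n < (Suc q)\<^sup>2\<close> leaves at most \<open>2 * q\<close>
          indices above \<open>q\<^sup>2\<close>.\<close>
        moreover have "real (n - q\<^sup>2) * B \<le> real (2 * q) * B"
          using q B by (intro mult_right_mono of_nat_mono) (auto simp: power2_eq_square)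
        ultimately have "norm (S n \<omega>) \<le> norm (S (q\<^sup>2) \<omega>) + 2 * real q * B"
          using norm_triangle_ineq[of "S (q\<^sup>2) \<omega>" "\<Sum>k\<in>{q\<^sup>2<..n}. V k \<omega>"] by simp
        then have "norm (S n \<omega> /\<^sub>R real n) \<le> (norm (S (q\<^sup>2) \<omega>) + 2 * real q * B) / real n"
          using elim by (simp add: divide_simps)
        also have "\<dots> \<le> (norm (S (q\<^sup>2) \<omega>) + 2 * real q * B) / real q ^ 2"
          using q elim B of_nat_mono[OF q(1), where 'a=real]
          by (intro divide_left_mono) (auto intro!: add_nonneg_nonneg mult_pos_pos)
        also have "\<dots> = norm (S (q\<^sup>2) \<omega>) / real q ^ 2 + 2 * B / real q"
          using q by (simp add: field_simps power2_eq_square)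
        finally show ?case by (simp add: q_def)
      qed
    qed
    then show ?case by (simp add: S_def)
  qed
qed

subsection \<open>Samples of independent, identically distributed random vectors\<close>

text \<open>The retained terms \<open>z\<^sup>2 / 2 ^ j\<close> form a geometric series starting at
  a level \<open>2 ^ j\<close> not below \<open>z\<close>, so its first term is at most
  \<open>z\<close>. Applied to \<open>norm X\<close>, this controls the normalized second moments of
  all truncations by the first moment alone.\<close>

lemma dyadic_truncated_sum_le:
  fixes z :: real
  assumes "0 \<le> z"
  shows "(\<Sum>j<N. (if z \<le> 2 ^ j then z else 0)\<^sup>2 / 2 ^ j) \<le> 2 * z"
proof -
  let ?F = "\<lambda>N. \<Sum>j<N. (if z \<le> 2 ^ j then z else 0)\<^sup>2 / 2 ^ j"
  \<comment> \<open>The correction \<open>2 * z\<^sup>2 / 2 ^ N\<close> is the tail of the geometric series, which makes the bound inductive.\<close>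
  have "(z \<le> 2 ^ N \<longrightarrow> ?F N \<le> 2 * z - 2 * z\<^sup>2 / 2 ^ N) \<and> (2 ^ N < z \<longrightarrow> ?F N = 0)"
  proof (induction N)
    case 0
    have "z \<le> 1 \<Longrightarrow> z * z \<le> z * 1" using assms by (intro mult_left_mono) auto
    then show ?case by (simp add: power2_eq_square)
  next
    case (Suc N)
    show ?case
    proof (cases "z \<le> 2 ^ N")
      case True
      moreover have "z \<le> 2 ^ Suc N"
        using True by (rule order_trans) simp
      moreover have "2 * z\<^sup>2 / 2 ^ N = 2 * (z\<^sup>2 / 2 ^ N)" "2 * z\<^sup>2 / 2 ^ Suc N = z\<^sup>2 / 2 ^ N"
        by simp_all
      ultimately show ?thesis using Suc by (simp del: power_Suc times_divide_eq_right)
    next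
      case False
      have "z * z \<le> 2 ^ Suc N * z" if "z \<le> 2 ^ Suc N"
        using that assms by (intro mult_right_mono) auto
      then show ?thesis using Suc False by (auto simp: field_simps power2_eq_square)
    qed
  qed
  then show ?thesis
    using assms by (cases "z \<le> 2 ^ N") (auto intro: order_trans)
qed

text \<open>The powers of 2 below \<open>z\<close> sum to less than twice the largest of them. With
  \<open>norm X\<close> for \<open>z\<close>, the left side has as expectation the expected total
  number of exceedances of level \<open>2 ^ j\<close> among \<open>2 ^ j\<close> observations, over
  all \<open>j < N\<close>.\<close>

lemma dyadic_tail_sum_le:
  fixes z :: real
  assumes "0 \<le> z"
  shows "(\<Sum>j<N. if 2 ^ j < z then 2 ^ j else 0) \<le> 2 * z"
proof (induction N)
  case (Suc N)
  have "(\<Sum>j<Suc N. if 2 ^ j < z then 2 ^ j else 0) \<le> (\<Sum>j<Suc N. 2 ^ j :: real)"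
    by (intro sum_mono) auto
  also have "\<dots> = 2 ^ Suc N - 1" by (simp add: sum_power2 mask_eq_sum_exp geometric_sum)
  finally show ?case using Suc by (cases "2 ^ N < z") auto
qed (use assms in simp)

lemma borel_measurable_cnj [measurable (raw)]:
  "f \<in> borel_measurable N \<Longrightarrow> (\<lambda>x. cnj (f x)) \<in> borel_measurable N"
  by (rule borel_measurable_continuous_on[OF continuous_on_cnj[OF continuous_on_id]])

locale iid_sample = prob_space M for M :: "'a measure" +
  fixes X :: "'a \<Rightarrow> 'b :: euclidean_space" and Xs :: "nat \<Rightarrow> 'a \<Rightarrow> 'b"
  assumes measurable_X [measurable]: "X \<in> borel_measurable M"
    and indep: "indep_vars (\<lambda>_. borel) Xs {1..}"
    and ident: "\<And>k. k \<ge> 1 \<Longrightarrow> distr M borel (Xs k) = distr M borel X"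
begin

lemma measurable_Xs: "k \<ge> 1 \<Longrightarrow> Xs k \<in> borel_measurable M"
  using indep by (auto simp: indep_vars_def)

lemma expectation_Xs:
  fixes h :: "'b \<Rightarrow> 'c :: {banach, second_countable_topology}"
  assumes "h \<in> borel_measurable borel" "k \<ge> 1"
  shows "expectation (\<lambda>\<omega>. h (Xs k \<omega>)) = expectation (\<lambda>\<omega>. h (X \<omega>))"
  using integral_distr[OF measurable_Xs[OF assms(2)] assms(1)] integral_distr[OF measurable_X assms(1)]
  by (simp add: ident[OF assms(2)])

lemma integrable_Xs_iff:
  fixes h :: "'b \<Rightarrow> 'c :: {banach, second_countable_topology}"
  assumes "h \<in> borel_measurable borel" "k \<ge> 1"
  shows "integrable M (\<lambda>\<omega>. h (Xs k \<omega>)) \<longleftrightarrow> integrable M (\<lambda>\<omega>. h (X \<omega>))"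
  using integrable_distr_eq[OF measurable_Xs[OF assms(2)] assms(1)] integrable_distr_eq[OF measurable_X assms(1)]
  by (simp add: ident[OF assms(2)])

lemma expectation_prod:
  fixes h :: "nat \<Rightarrow> 'b \<Rightarrow> 'c :: {real_normed_field, banach, second_countable_topology}"
  assumes I: "finite I" "I \<subseteq> {1..}"
    and h: "\<And>i. i \<in> I \<Longrightarrow> h i \<in> borel_measurable borel"
    and int: "\<And>i. i \<in> I \<Longrightarrow> integrable M (\<lambda>\<omega>. h i (X \<omega>))"
  shows "expectation (\<lambda>\<omega>. \<Prod>i\<in>I. h i (Xs i \<omega>)) = (\<Prod>i\<in>I. expectation (\<lambda>\<omega>. h i (X \<omega>)))"
proof -
  have "expectation (\<lambda>\<omega>. \<Prod>i\<in>I. h i (Xs i \<omega>)) = (\<Prod>i\<in>I. expectation (\<lambda>\<omega>. h i (Xs i \<omega>)))"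
  proof (rule indep_vars_lebesgue_integral)
    show "indep_vars (\<lambda>_. borel) (\<lambda>i \<omega>. h i (Xs i \<omega>)) I"
      using indep_vars_compose2[OF indep_vars_subset[OF indep I(2)], of h "\<lambda>_. borel"] h by simp
    show "integrable M (\<lambda>\<omega>. h i (Xs i \<omega>))" if "i \<in> I" for i
      using integrable_Xs_iff[OF h[OF that], of i] int[OF that] that I(2) by auto
  qed (rule I)
  also have "\<dots> = (\<Prod>i\<in>I. expectation (\<lambda>\<omega>. h i (X \<omega>)))"
    using I h by (intro prod.cong refl expectation_Xs) auto
  finally show ?thesis .
qed

text \<open>Each window of \<open>d\<close> consecutive sample points has the product of the single
  means as its mean, because its factors are independent. Windows starting at least \<open>d\<close>
  apart use disjoint sets of sample points and are uncorrelated, which feeds the second moment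
  bound. The indices run on without wrapping around; \<open>d = 1\<close> is the ordinary strong
  law.\<close>

lemma moving_product_strong_law:
  fixes h :: "nat \<Rightarrow> 'b \<Rightarrow> complex"
  assumes h [measurable]: "\<And>j. h j \<in> borel_measurable borel"
    and bounded: "\<And>j x. cmod (h j x) \<le> 1"
  shows "AE \<omega> in M. (\<lambda>n. (1 / of_nat n) * (\<Sum>k=1..n. \<Prod>j=1..d. h j (Xs (k + j - 1) \<omega>)))
           \<longlonglongrightarrow> (\<Prod>j=1..d. expectation (\<lambda>\<omega>. h j (X \<omega>)))"
proof -
  define W where "W k \<omega> = (\<Prod>j=1..d. h j (Xs (k + j - 1) \<omega>))" for k \<omega>
  define m where "m = (\<Prod>j=1..d. expectation (\<lambda>\<omega>. h j (X \<omega>)))"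
  have W_meas [measurable]: "W k \<in> borel_measurable M" if "k \<ge> 1" for k
    unfolding W_def using that
    by (intro borel_measurable_prod measurable_compose[OF measurable_Xs h]) auto
  have W_le: "cmod (W k \<omega>) \<le> 1" for k \<omega>
  proof -
    have "cmod (W k \<omega>) \<le> (\<Prod>j=1..d. cmod (h j (Xs (k + j - 1) \<omega>)))"
      unfolding W_def by (rule norm_prod_le)
    also have "\<dots> \<le> 1" by (intro prod_le_1) (auto simp: bounded)
    finally show ?thesis .
  qed
  have int_h: "integrable M (\<lambda>\<omega>. h j (X \<omega>))" for j
    by (rule integrable_const_bound[where B = 1]) (auto simp: bounded)
  have int_W: "integrable M (W k)" if "k \<ge> 1" for k
    by (rule integrable_const_bound[where B = 1]) (use that W_le in auto)
  \<comment> \<open>Indexing by the sample point \<open>i = k + j - 1\<close> instead of the factor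
    \<open>j\<close> exposes a product over distinct independent variables and turns the overlap of
    two windows into an intersection of intervals.\<close>
  have W_eq: "W k \<omega> = (\<Prod>i\<in>{k..<k+d}. h (i + 1 - k) (Xs i \<omega>))" for k \<omega>
    unfolding W_def by (rule prod.reindex_bij_witness[of _ "\<lambda>i. i + 1 - k" "\<lambda>j. k + j - 1"]) auto
  have m_eq: "m = (\<Prod>i\<in>{k..<k+d}. expectation (\<lambda>\<omega>. h (i + 1 - k) (X \<omega>)))" for k
    unfolding m_def by (rule prod.reindex_bij_witness[of _ "\<lambda>i. i + 1 - k" "\<lambda>j. k + j - 1"]) auto
  have E_W: "expectation (W k) = m" if "k \<ge> 1" for k
    unfolding W_eq m_eq[of k] using that by (intro expectation_prod int_h h) auto
  have E_WW: "expectation (\<lambda>\<omega>. W k \<omega> * cnj (W l \<omega>)) = m * cnj m" if kl: "k \<ge> 1" "k + d \<le> l" for k l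
  proof -
    \<comment> \<open>One family covers both windows, so that the mixed moment is the expectation of
      a single product over their disjoint union. As \<open>k + d \<le> l\<close>, the test
      \<open>i < k + d\<close> tells the windows apart.\<close>
    define g where "g i x = (if i < k + d then h (i + 1 - k) x else cnj (h (i + 1 - l) x))" for i x
    have g [measurable]: "g i \<in> borel_measurable borel" for i
      unfolding g_def by (cases "i < k + d") auto
    have int_g: "integrable M (\<lambda>\<omega>. g i (X \<omega>))" for i
      unfolding g_def by (cases "i < k + d") (simp_all add: int_h)
    have disj: "{k..<k+d} \<inter> {l..<l+d} = {}" using kl by auto
    have g_k: "g i x = h (i + 1 - k) x" if "i \<in> {k..<k+d}" for i x
      using that by (simp add: g_def)
    have g_l: "g i x = cnj (h (i + 1 - l) x)" if "i \<in> {l..<l+d}" for i x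
      using that kl by (simp add: g_def)
    have "W k \<omega> * cnj (W l \<omega>) = (\<Prod>i\<in>{k..<k+d} \<union> {l..<l+d}. g i (Xs i \<omega>))" for \<omega>
      unfolding W_eq[of k] W_eq[of l] cnj_prod prod.union_disjoint[OF finite_atLeastLessThan finite_atLeastLessThan disj]
      by (intro arg_cong2[where f = "(*)"] prod.cong refl) (simp_all only: g_k g_l)
    then have "expectation (\<lambda>\<omega>. W k \<omega> * cnj (W l \<omega>))
        = expectation (\<lambda>\<omega>. \<Prod>i\<in>{k..<k+d} \<union> {l..<l+d}. g i (Xs i \<omega>))"
      by simp
    also have "\<dots> = (\<Prod>i\<in>{k..<k+d} \<union> {l..<l+d}. expectation (\<lambda>\<omega>. g i (X \<omega>)))"
      using kl by (intro expectation_prod g int_g) auto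
    also have "\<dots> = (\<Prod>i\<in>{k..<k+d}. expectation (\<lambda>\<omega>. h (i + 1 - k) (X \<omega>)))
        * (\<Prod>i\<in>{l..<l+d}. expectation (\<lambda>\<omega>. cnj (h (i + 1 - l) (X \<omega>))))"
      unfolding prod.union_disjoint[OF finite_atLeastLessThan finite_atLeastLessThan disj]
      by (intro arg_cong2[where f = "(*)"] prod.cong refl) (simp_all only: g_k g_l)
    also have "\<dots> = m * cnj m"
    proof (rule arg_cong2[where f = "(*)"])
      show "(\<Prod>i\<in>{k..<k+d}. expectation (\<lambda>\<omega>. h (i + 1 - k) (X \<omega>))) = m"
        by (rule m_eq[symmetric])
      show "(\<Prod>i\<in>{l..<l+d}. expectation (\<lambda>\<omega>. cnj (h (i + 1 - l) (X \<omega>)))) = cnj m"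
        unfolding m_eq[of l] cnj_prod by (intro prod.cong refl Bochner_Integration.integral_cnj)
    qed
    finally show ?thesis .
  qed
  define V where "V k \<omega> = W k \<omega> - m" for k \<omega>
  have m_le: "cmod m \<le> 1"
  proof -
    have "cmod m \<le> (\<Prod>j=1..d. cmod (expectation (\<lambda>\<omega>. h j (X \<omega>))))"
      unfolding m_def by (rule norm_prod_le)
    also have "\<dots> \<le> 1"
    proof (intro prod_le_1 conjI)
      fix j
      have "cmod (expectation (\<lambda>\<omega>. h j (X \<omega>))) \<le> expectation (\<lambda>\<omega>. cmod (h j (X \<omega>)))"
        by (rule integral_norm_bound)
      also have "\<dots> \<le> expectation (\<lambda>\<omega>. 1)"
        by (intro integral_mono integrable_norm int_h) (auto simp: bounded)
      finally show "cmod (expectation (\<lambda>\<omega>. h j (X \<omega>))) \<le> 1" by (simp add: prob_space)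
    qed auto
    finally show ?thesis .
  qed
  have V_le: "cmod (V k \<omega>) \<le> 2" for k \<omega>
    using norm_triangle_ineq4[of "W k \<omega>" m] W_le[of k \<omega>] m_le by (simp add: V_def)
  have V_sq_le: "(cmod (V k \<omega>))\<^sup>2 \<le> 4" for k \<omega>
    using power_mono[OF V_le, of k \<omega> 2] by simp
  have V_meas [measurable]: "V k \<in> borel_measurable M" if "k \<ge> 1" for k
    using that unfolding V_def by simp
  have int_V2: "integrable M (\<lambda>\<omega>. (cmod (V k \<omega>))\<^sup>2)" if "k \<ge> 1" for k
    by (rule integrable_const_bound[where B = 4]) (use that V_sq_le in auto)
  have orth: "expectation (\<lambda>\<omega>. V k \<omega> \<bullet> V l \<omega>) = 0" if kl: "k \<ge> 1" "k + d \<le> l" for k l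
  proof -
    have l: "l \<ge> 1" using kl by simp
    have int_WW: "integrable M (\<lambda>\<omega>. W k \<omega> * cnj (W l \<omega>))"
      by (rule integrable_const_bound[where B = 1])
        (use kl l W_le in \<open>auto simp: norm_mult intro!: mult_le_one\<close>)
    have int1: "integrable M (\<lambda>\<omega>. W k \<omega> * cnj m)"
      by (intro integrable_mult_left int_W kl)
    have int2: "integrable M (\<lambda>\<omega>. m * cnj (W l \<omega>))"
      by (intro integrable_mult_right Bochner_Integration.integrable_cnj int_W l)
    have int3: "integrable M (\<lambda>\<omega>. W k \<omega> * cnj (W l \<omega>) - W k \<omega> * cnj m)"
      by (rule Bochner_Integration.integrable_diff[OF int_WW int1])
    have int4: "integrable M (\<lambda>\<omega>. m * cnj m - m * cnj (W l \<omega>))"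
      by (rule Bochner_Integration.integrable_diff[OF _ int2]) simp
    \<comment> \<open>The inner product of complex numbers is \<open>Re (z * cnj w)\<close>. The
      expansion is grouped to match the integrability facts; all four expectations equal
      \<open>m * cnj m\<close>.\<close>
    have "V k \<omega> \<bullet> V l \<omega>
        = Re ((W k \<omega> * cnj (W l \<omega>) - W k \<omega> * cnj m) + (m * cnj m - m * cnj (W l \<omega>)))" for \<omega>
      by (simp add: V_def inner_complex_def algebra_simps)
    then have "expectation (\<lambda>\<omega>. V k \<omega> \<bullet> V l \<omega>)
        = Re (expectation (\<lambda>\<omega>. (W k \<omega> * cnj (W l \<omega>) - W k \<omega> * cnj m) + (m * cnj m - m * cnj (W l \<omega>))))"
      by (simp only: integral_Re[OF Bochner_Integration.integrable_add[OF int3 int4]])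
    also have "expectation (\<lambda>\<omega>. (W k \<omega> * cnj (W l \<omega>) - W k \<omega> * cnj m) + (m * cnj m - m * cnj (W l \<omega>)))
        = expectation (\<lambda>\<omega>. W k \<omega> * cnj (W l \<omega>)) - expectation (\<lambda>\<omega>. W k \<omega> * cnj m)
          + (m * cnj m - expectation (\<lambda>\<omega>. m * cnj (W l \<omega>)))"
      unfolding Bochner_Integration.integral_add[OF int3 int4]
        Bochner_Integration.integral_diff[OF int_WW int1]
      by (subst Bochner_Integration.integral_diff[OF _ int2]) (simp_all add: prob_space)
    also have "expectation (\<lambda>\<omega>. W k \<omega> * cnj m) = m * cnj m"
      using E_W[OF kl(1)] by simp
    also have "expectation (\<lambda>\<omega>. m * cnj (W l \<omega>)) = m * cnj m"
      using E_W[OF l] by simp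
    finally show ?thesis using E_WW[OF kl] by simp
  qed
  have "AE \<omega> in M. (\<lambda>n. (\<Sum>k=1..n. V k \<omega>) /\<^sub>R real n) \<longlonglongrightarrow> 0"
  proof (rule bounded_strong_law)
    show "cmod (V k \<omega>) \<le> 2" for k \<omega> by (rule V_le)
    have E_V2: "expectation (\<lambda>\<omega>. (cmod (V k \<omega>))\<^sup>2) \<le> 4" if "k \<in> {1..n}" for k n
      using integral_mono[OF int_V2[of k], of "\<lambda>_. 4"] that by (simp add: prob_space V_sq_le)
    show "integrable M (\<lambda>\<omega>. (cmod (\<Sum>k=1..n. V k \<omega>))\<^sup>2)" for n
      by (rule second_moment_sum_le[where B = 4 and d = d]) (auto intro: int_V2 E_V2 orth)
    have "expectation (\<lambda>\<omega>. (cmod (\<Sum>k=1..n. V k \<omega>))\<^sup>2) \<le> 2 * real d * 4 * real (card {1..n})" for n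
      by (rule second_moment_sum_le(2)[where B = 4 and d = d and A = "{1..n}" and U = V]) (auto intro: int_V2 E_V2 orth)
    then show "expectation (\<lambda>\<omega>. (cmod (\<Sum>k=1..n. V k \<omega>))\<^sup>2) \<le> 2 * real d * 4 * real n" for n
      by simp
  qed
  then show ?thesis
  proof eventually_elim
    case (elim \<omega>)
    have "(\<lambda>n. (\<Sum>k=1..n. V k \<omega>) /\<^sub>R real n + m) \<longlonglongrightarrow> 0 + m"
      by (intro tendsto_add elim tendsto_const)
    moreover have "\<forall>\<^sub>F n in sequentially.
        (\<Sum>k=1..n. V k \<omega>) /\<^sub>R real n + m = (1 / of_nat n) * (\<Sum>k=1..n. W k \<omega>)"
      using eventually_gt_at_top[of 0]
    proof eventually_elim
      case (elim n)
      then show ?case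
        by (simp add: V_def sum_subtractf scaleR_conv_of_real divide_simps)
    qed
    ultimately show ?case
      using Lim_transform_eventually unfolding W_def m_def by fastforce
  qed
qed

text \<open>
  Etemadi's argument, which needs only the sample sizes \<open>2 ^ j\<close> here: truncate at level \<open>2 ^ j\<close>.
\<close>
lemma AE_bounded_norm_means:
  assumes int: "integrable M (\<lambda>\<omega>. norm (X \<omega>))"
  shows "AE \<omega> in M. \<exists>C. \<forall>n. (\<Sum>k=1..n. norm (Xs k \<omega>)) \<le> C * real n"
proof -
  define \<mu> where "\<mu> = expectation (\<lambda>\<omega>. norm (X \<omega>))"
  define \<tau> :: "nat \<Rightarrow> 'b \<Rightarrow> real" where "\<tau> j x = (if norm x \<le> 2 ^ j then norm x else 0)" for j x
  define \<beta> :: "nat \<Rightarrow> 'b \<Rightarrow> real" where "\<beta> j x = (if 2 ^ j < norm x then 1 else 0)" for j x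
  define e where "e j = expectation (\<lambda>\<omega>. \<tau> j (X \<omega>))" for j
  define s where "s j = expectation (\<lambda>\<omega>. (\<tau> j (X \<omega>))\<^sup>2)" for j
  \<comment> \<open>\<open>D\<close> is the centred truncated sum and \<open>T\<close> counts the
    exceedances among the first \<open>2 ^ j\<close> observations. Once \<open>T\<close> is below 1
    the truncation changes nothing, and the sample sum is \<open>D j\<close> plus
    \<open>2 ^ j * e j\<close>.\<close>
  define D where "D j \<omega> = (\<Sum>k=1..2^j. \<tau> j (Xs k \<omega>) - e j)" for j \<omega>
  define T where "T j \<omega> = (\<Sum>k=1..2^j. \<beta> j (Xs k \<omega>))" for j \<omega>
  have [measurable]: "\<tau> j \<in> borel_measurable borel" "\<beta> j \<in> borel_measurable borel" for j
    unfolding \<tau>_def \<beta>_def by measurable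
  have \<tau>: "0 \<le> \<tau> j x" "\<tau> j x \<le> 2 ^ j" "\<tau> j x \<le> norm x" for j x by (auto simp: \<tau>_def)
  have int_\<tau>: "integrable M (\<lambda>\<omega>. \<tau> j (X \<omega>))" for j
    by (rule integrable_const_bound[where B = "2 ^ j"]) (auto simp: \<tau>)
  have int_\<tau>2: "integrable M (\<lambda>\<omega>. (\<tau> j (X \<omega>))\<^sup>2)" for j
    by (rule integrable_const_bound[where B = "(2 ^ j)\<^sup>2"]) (auto simp: \<tau> intro!: power_mono)
  have int_\<beta>: "integrable M (\<lambda>\<omega>. \<beta> j (X \<omega>))" for j
    by (rule integrable_const_bound[where B = 1]) (auto simp: \<beta>_def)
  have e_le: "e j \<le> \<mu>" for j
    unfolding e_def \<mu>_def by (intro integral_mono int_\<tau> int) (rule \<tau>)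
  have sum_s: "summable (\<lambda>j. s j / 2 ^ j)"
  proof (rule summableI_nonneg_bounded)
    show "0 \<le> s j / 2 ^ j" for j by (simp add: s_def)
    have "(\<Sum>j<N. s j / 2 ^ j) = expectation (\<lambda>\<omega>. \<Sum>j<N. (\<tau> j (X \<omega>))\<^sup>2 / 2 ^ j)" for N
      by (simp add: s_def int_\<tau>2 Bochner_Integration.integral_sum)
    also have "\<dots> N \<le> expectation (\<lambda>\<omega>. 2 * norm (X \<omega>))" for N
    proof (intro integral_mono)
      show "(\<Sum>j<N. (\<tau> j (X \<omega>))\<^sup>2 / 2 ^ j) \<le> 2 * norm (X \<omega>)" for \<omega>
        using dyadic_truncated_sum_le[of "norm (X \<omega>)" N] by (simp add: \<tau>_def)
    qed (auto intro!: int int_\<tau>2)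
    finally show "(\<Sum>j<N. s j / 2 ^ j) \<le> 2 * \<mu>" for N by (simp add: \<mu>_def)
  qed
  have sum_\<beta>: "summable (\<lambda>j. 2 ^ j * expectation (\<lambda>\<omega>. \<beta> j (X \<omega>)))"
  proof (rule summableI_nonneg_bounded)
    show "0 \<le> 2 ^ j * expectation (\<lambda>\<omega>. \<beta> j (X \<omega>))" for j by (simp add: \<beta>_def)
    have "(\<Sum>j<N. 2 ^ j * expectation (\<lambda>\<omega>. \<beta> j (X \<omega>)))
        = expectation (\<lambda>\<omega>. \<Sum>j<N. 2 ^ j * \<beta> j (X \<omega>))" for N
      by (simp add: int_\<beta> Bochner_Integration.integral_sum)
    also have "\<dots> N \<le> expectation (\<lambda>\<omega>. 2 * norm (X \<omega>))" for N
    proof (intro integral_mono)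
      show "(\<Sum>j<N. 2 ^ j * \<beta> j (X \<omega>)) \<le> 2 * norm (X \<omega>)" for \<omega>
        using dyadic_tail_sum_le[of "norm (X \<omega>)" N] by (simp add: \<beta>_def if_distrib cong: if_cong)
    qed (auto intro!: int int_\<beta>)
    finally show "(\<Sum>j<N. 2 ^ j * expectation (\<lambda>\<omega>. \<beta> j (X \<omega>))) \<le> 2 * \<mu>" for N by (simp add: \<mu>_def)
  qed
  have AE_T: "AE \<omega> in M. (\<lambda>j. T j \<omega>) \<longlonglongrightarrow> 0"
  proof (rule AE_tendsto_zero_of_summable_integral)
    have int: "integrable M (\<lambda>\<omega>. \<beta> j (Xs k \<omega>))" if "k \<in> {1..2^j}" for j k
      using that by (subst integrable_Xs_iff) (auto simp: int_\<beta>)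
    show "integrable M (T j)" for j
      unfolding T_def by (intro Bochner_Integration.integrable_sum int)
    have "expectation (T j) = (\<Sum>k=1..2^j. expectation (\<lambda>\<omega>. \<beta> j (Xs k \<omega>)))" for j
      unfolding T_def by (intro Bochner_Integration.integral_sum int)
    also have "\<dots> j = (\<Sum>k=1..2^j::nat. expectation (\<lambda>\<omega>. \<beta> j (X \<omega>)))" for j
      by (intro sum.cong refl expectation_Xs) auto
    finally have "expectation (T j) = 2 ^ j * expectation (\<lambda>\<omega>. \<beta> j (X \<omega>))" for j by simp
    with sum_\<beta> show "summable (\<lambda>j. expectation (T j))" by simp
    show "0 \<le> T j \<omega>" for j \<omega> unfolding T_def by (intro sum_nonneg) (auto simp: \<beta>_def)
  qed
  have D2: "integrable M (\<lambda>\<omega>. (norm (D j \<omega>))\<^sup>2 / 4 ^ j)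
      \<and> expectation (\<lambda>\<omega>. (norm (D j \<omega>))\<^sup>2 / 4 ^ j) \<le> 2 * (s j / 2 ^ j)" for j
  proof -
    define h where "h x = \<tau> j x - e j" for x
    have [measurable]: "h \<in> borel_measurable borel" unfolding h_def by measurable
    have int_h: "integrable M (\<lambda>\<omega>. h (X \<omega>))" by (simp add: h_def int_\<tau>)
    have E_h: "expectation (\<lambda>\<omega>. h (X \<omega>)) = 0" by (simp add: h_def int_\<tau> e_def prob_space)
    have int_h2: "integrable M (\<lambda>\<omega>. (h (X \<omega>))\<^sup>2)"
      unfolding h_def power2_diff
      by (intro Bochner_Integration.integrable_add Bochner_Integration.integrable_diff int_\<tau>2) (auto simp: int_\<tau>)
    \<comment> \<open>The squared mean is dropped from the variance, since the summability above is
      that of the raw second moments.\<close>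
    have E_h2: "expectation (\<lambda>\<omega>. (h (X \<omega>))\<^sup>2) \<le> s j"
      using variance_eq[OF int_\<tau> int_\<tau>2] by (simp add: h_def e_def s_def)
    have [measurable]: "(\<lambda>\<omega>. h (Xs k \<omega>)) \<in> borel_measurable M" if "k \<ge> 1" for k
      using measurable_compose[OF measurable_Xs[OF that], of h borel] by simp
    have int_h2': "integrable M (\<lambda>\<omega>. (norm (h (Xs k \<omega>)))\<^sup>2)" if "k \<ge> 1" for k
      using that int_h2 integrable_Xs_iff[of "\<lambda>x. (h x)\<^sup>2" k] by simp
    have E_h2': "expectation (\<lambda>\<omega>. (norm (h (Xs k \<omega>)))\<^sup>2) \<le> s j" if "k \<ge> 1" for k
      using that E_h2 expectation_Xs[of "\<lambda>x. (h x)\<^sup>2" k] by simp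
    have orth: "expectation (\<lambda>\<omega>. h (Xs k \<omega>) \<bullet> h (Xs l \<omega>)) = 0" if "k \<ge> 1" "k + 1 \<le> l" for k l
      using expectation_prod[of "{k, l}" "\<lambda>_. h"] that int_h E_h by simp
    have D_eq: "D j \<omega> = (\<Sum>k=1..2^j. h (Xs k \<omega>))" for \<omega> by (simp add: D_def h_def)
    have int_D: "integrable M (\<lambda>\<omega>. (norm (D j \<omega>))\<^sup>2)"
      unfolding D_eq
      by (rule second_moment_sum_le[where B = "s j" and d = 1]) (auto intro!: int_h2' E_h2' orth simp del: real_norm_def inner_real_def)
    \<comment> \<open>Independence corresponds to \<open>d = 1\<close>, since distinct indices
      differ by at least 1. The \<open>2 ^ j\<close> summands against the normalization
      \<open>4 ^ j\<close> leave the factor \<open>1 / 2 ^ j\<close>.\<close>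
    have "expectation (\<lambda>\<omega>. (norm (D j \<omega>))\<^sup>2) \<le> 2 * real 1 * s j * real (card {1..2^j::nat})"
      unfolding D_eq
      by (rule second_moment_sum_le(2)[where B = "s j" and d = 1 and A = "{1..2^j}" and U = "\<lambda>k \<omega>. h (Xs k \<omega>)"])
        (auto intro!: int_h2' E_h2' orth simp del: real_norm_def inner_real_def)
    then have "expectation (\<lambda>\<omega>. (norm (D j \<omega>))\<^sup>2) / 4 ^ j \<le> (2 * real 1 * s j * real (card {1..2^j::nat})) / 4 ^ j"
      by (rule divide_right_mono) simp
    also have "\<dots> = 2 * (s j / 2 ^ j)"
      by (simp add: field_simps flip: power_mult_distrib)
    finally show ?thesis using int_D by simp
  qed
  have AE_D: "AE \<omega> in M. (\<lambda>j. (norm (D j \<omega>))\<^sup>2 / 4 ^ j) \<longlonglongrightarrow> 0"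
  proof (rule AE_tendsto_zero_of_summable_integral)
    show "summable (\<lambda>j. expectation (\<lambda>\<omega>. (norm (D j \<omega>))\<^sup>2 / 4 ^ j))"
      by (rule summable_comparison_test'[OF summable_mult[OF sum_s, of 2], of 0]) (use D2 in auto)
  qed (use D2 in auto)
  show ?thesis using AE_T AE_D
  proof eventually_elim
    case (elim \<omega>)
    define S where "S n = (\<Sum>k=1..n. norm (Xs k \<omega>))" for n
    have S_mono: "S n \<le> S n'" if "n \<le> n'" for n n'
      unfolding S_def using that by (intro sum_mono2) auto
    have S_nonneg: "0 \<le> S n" for n unfolding S_def by (intro sum_nonneg) auto
    have \<mu>: "0 \<le> \<mu>" by (simp add: \<mu>_def)
    have "\<forall>\<^sub>F j in sequentially. T j \<omega> < 1" "\<forall>\<^sub>F j in sequentially. (norm (D j \<omega>))\<^sup>2 / 4 ^ j < 1"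
      using order_tendstoD(2)[OF elim(1), of 1] order_tendstoD(2)[OF elim(2), of 1] by simp_all
    then have "\<forall>\<^sub>F j in sequentially. S (2 ^ j) \<le> 2 ^ j * (1 + \<mu>)"
    proof eventually_elim
      case (elim j)
      \<comment> \<open>\<open>T j\<close> is a sum of indicators, so a single exceedance would
        already make it at least 1.\<close>
      have small: "norm (Xs k \<omega>) \<le> 2 ^ j" if "k \<in> {1..2^j}" for k
      proof (rule ccontr)
        assume "\<not> ?thesis"
        then have "1 = \<beta> j (Xs k \<omega>)" by (simp add: \<beta>_def)
        also have "\<dots> \<le> T j \<omega>"
          unfolding T_def using that by (intro member_le_sum) (auto simp: \<beta>_def)
        finally show False using elim by simp
      qed
      have "(4 :: real) ^ j = (2 ^ j)\<^sup>2"
        by (simp add: power2_eq_square flip: power_mult_distrib)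
      then have "(norm (D j \<omega>))\<^sup>2 < (2 ^ j)\<^sup>2"
        using elim(2) by (simp add: divide_simps)
      then have "norm (D j \<omega>) < 2 ^ j" by (rule power_less_imp_less_base) simp
      moreover have "S (2 ^ j) = D j \<omega> + 2 ^ j * e j"
        unfolding S_def D_def using small by (simp add: sum_subtractf \<tau>_def)
      moreover have "2 ^ j * e j \<le> 2 ^ j * \<mu>" using e_le by simp
      ultimately show ?case unfolding distrib_left real_norm_def by linarith
    qed
    then obtain J where J: "S (2 ^ j) \<le> 2 ^ j * (1 + \<mu>)" if "j \<ge> J" for j
      by (auto simp: eventually_at_top_linorder)
    \<comment> \<open>Below \<open>2 ^ J\<close> the sums are bounded by \<open>S (2 ^ J)\<close>,
      and \<open>n \<ge> 1\<close> supplies the factor. Beyond it, \<open>n\<close> is rounded up to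
      a power of 2 that is at most \<open>2 * n\<close>, which is the origin of the 2.\<close>
    have "S n \<le> max (S (2 ^ J)) (2 * (1 + \<mu>)) * real n" for n
    proof -
      consider "n = 0" | "1 \<le> n" "n < 2 ^ J" | "1 \<le> n" "2 ^ J \<le> n" by linarith
      then show ?thesis
      proof cases
        case 1
        then show ?thesis by (simp add: S_def)
      next
        case 2
        have "S n \<le> S (2 ^ J) * 1" using 2 S_mono[of n "2 ^ J"] by simp
        also have "\<dots> \<le> max (S (2 ^ J)) (2 * (1 + \<mu>)) * real n"
          using 2 S_nonneg \<mu> by (intro mult_mono) auto
        finally show ?thesis .
      next
        case 3
        obtain j where j: "2 ^ j \<le> n" "n < 2 ^ (j + 1)"
          using ex_power_ivl1[of 2 n] 3 by auto
        have "J < j + 1"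
          using 3 j by (meson le_less_trans power_strict_increasing_iff one_less_numeral_iff semiring_norm(76))
        then have "S n \<le> 2 ^ (j + 1) * (1 + \<mu>)"
          using J[of "j + 1"] S_mono[of n "2 ^ (j + 1)"] j by simp
        also have "\<dots> = 2 * (1 + \<mu>) * real (2 ^ j)" by simp
        also have "\<dots> \<le> max (S (2 ^ J)) (2 * (1 + \<mu>)) * real n"
          using j \<mu> by (intro mult_mono) auto
        finally show ?thesis .
      qed
    qed
    then show ?case unfolding S_def by blast
  qed
qed

lemma strong_law:
  fixes h :: "'b \<Rightarrow> complex"
  assumes "h \<in> borel_measurable borel" "\<And>x. cmod (h x) \<le> 1"
  shows "AE \<omega> in M. (\<lambda>n. (1 / of_nat n) * (\<Sum>k=1..n. h (Xs k \<omega>))) \<longlonglongrightarrow> expectation (\<lambda>\<omega>. h (X \<omega>))"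
  using moving_product_strong_law[of "\<lambda>_. h" 1] assms by simp

end

subsection \<open>Integrability with respect to the weight\<close>

lemma ex_dyadic_interval:
  fixes x :: real
  assumes "1 \<le> x"
  shows "\<exists>k. 2 ^ k \<le> x \<and> x \<le> 2 ^ Suc k"
proof -
  have "1 \<le> nat \<lfloor>x\<rfloor>" using assms by linarith
  then obtain k where k: "2 ^ k \<le> nat \<lfloor>x\<rfloor>" "nat \<lfloor>x\<rfloor> < 2 ^ (k + 1)"
    using ex_power_ivl1[of 2 "nat \<lfloor>x\<rfloor>"] by auto
  have "(2 :: real) ^ k \<le> real (nat \<lfloor>x\<rfloor>)"
    using of_nat_mono[OF k(1), where 'a=real] unfolding of_nat_power of_nat_numeral .
  moreover have "real (nat \<lfloor>x\<rfloor>) + 1 \<le> 2 ^ Suc k"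
    using of_nat_mono[of "nat \<lfloor>x\<rfloor> + 1" "2 ^ Suc k", where 'a=real] k(2)
    unfolding of_nat_power of_nat_numeral of_nat_add of_nat_1 by simp
  moreover have "real (nat \<lfloor>x\<rfloor>) \<le> x" "x \<le> real (nat \<lfloor>x\<rfloor>) + 1" using assms by linarith+
  ultimately show ?thesis by (meson order_trans)
qed

text \<open>The function lies below the sum of the steps of height \<open>a k\<close> on the ball of
  radius \<open>r k\<close>, and ball volumes scale as \<open>r k ^ DIM('a)\<close>. For dyadic
  radii, whole balls in place of shells cost only a constant factor, and polar coordinates are
  avoided. The origin is exempt because it lies in no dyadic shell.\<close>

lemma nn_integral_less_top_of_ball_cover:
  fixes f :: "'a :: euclidean_space \<Rightarrow> real"
  assumes cover: "\<And>x. x \<noteq> 0 \<Longrightarrow> 0 < f x \<Longrightarrow> \<exists>k. norm x \<le> r k \<and> f x \<le> a k"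
    and nonneg: "\<And>k::nat. 0 \<le> r k" "\<And>k. 0 \<le> a k"
    and summable: "summable (\<lambda>k. a k * r k ^ DIM('a))"
  shows "(\<integral>\<^sup>+x. ennreal (f x) \<partial>lborel) < \<infinity>"
proof -
  have [measurable]: "cball (0 :: 'a) c \<in> sets borel" for c by simp
  have "(\<integral>\<^sup>+x. ennreal (f x) \<partial>lborel)
      \<le> (\<integral>\<^sup>+x. (\<Sum>k. ennreal (a k) * indicator (cball (0 :: 'a) (r k)) x) \<partial>lborel)"
  proof (rule nn_integral_mono_AE)
    show "AE x in lborel. ennreal (f x) \<le> (\<Sum>k. ennreal (a k) * indicator (cball (0 :: 'a) (r k)) x)"
      using AE_lborel_singleton[of 0]
    proof eventually_elim
      case (elim x)
      show ?case
      proof (cases "0 < f x")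
        case True
        then obtain k where k: "norm x \<le> r k" "f x \<le> a k" using cover elim by blast
        have "ennreal (f x) \<le> (\<Sum>i\<in>{k}. ennreal (a i) * indicator (cball (0 :: 'a) (r i)) x)"
          using k by (simp add: ennreal_leI)
        also have "\<dots> \<le> (\<Sum>i. ennreal (a i) * indicator (cball (0 :: 'a) (r i)) x)"
          by (rule sum_le_suminf) auto
        finally show ?thesis .
      qed (simp add: ennreal_neg)
    qed
  qed
  also have "\<dots> = (\<Sum>k. ennreal (a k) * emeasure lborel (cball (0 :: 'a) (r k)))"
    by (subst nn_integral_suminf, measurable) (simp add: nn_integral_cmult_indicator)
  also have "\<dots> = (\<Sum>k. ennreal (unit_ball_vol DIM('a) * (a k * r k ^ DIM('a))))"
    using nonneg by (simp add: emeasure_cball mult_ac flip: ennreal_mult')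
  also have "\<dots> < \<infinity>"
    unfolding infinity_ennreal_def less_top[symmetric]
    using nonneg by (intro ennreal_suminf_neq_top summable_mult summable) auto
  finally show ?thesis .
qed

lemma K_pos: "0 < K q"
  by (simp add: K_def Gamma_real_pos)

lemma w1_nonneg: "0 \<le> w1 (t :: real ^ 'n::finite)"
  using K_pos[of "CARD('n)"] by (simp add: w1_def)

lemma measurable_w1 [measurable]: "w1 \<in> borel_measurable borel"
  unfolding w1_def by measurable

lemma nn_integral_min_w1:
  "(\<integral>\<^sup>+t. ennreal (min 1 ((norm t)\<^sup>2) * w1 (t :: real ^ 'n::finite)) \<partial>lborel) < \<infinity>"
proof -
  define p where "p = CARD('n)"
  have p: "1 \<le> p" "DIM(real ^ 'n) = p" by (simp_all add: p_def Suc_leI)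
  define g :: "real ^ 'n \<Rightarrow> real" where "g t = min 1 ((norm t)\<^sup>2) / norm t ^ (p + 1)" for t
  \<comment> \<open>Since \<open>g\<close> is at most \<open>norm t ^ (- p - 1)\<close> outside and \<open>norm t ^ (1 - p)\<close> inside the unit ball, dyadic
    shells contribute terms of a geometric series in both regions.\<close>
  have outer: "(\<integral>\<^sup>+t. ennreal (if 1 \<le> norm t then g t else 0) \<partial>lborel) < \<infinity>"
  proof (rule nn_integral_less_top_of_ball_cover)
    fix t :: "real ^ 'n" assume "0 < (if 1 \<le> norm t then g t else 0)"
    then have t: "1 \<le> norm t" by (simp split: if_splits)
    \<comment> \<open>The inner radius of the shell bounds \<open>g\<close>, the outer radius gives
      the ball. With exponents \<open>p + 1\<close> and \<open>p\<close>, value times volume retains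
      one factor \<open>1 / 2 ^ k\<close>.\<close>
    then obtain k where k: "2 ^ k \<le> norm t" "norm t \<le> 2 ^ Suc k"
      using ex_dyadic_interval by blast
    have "g t \<le> 1 / norm t ^ (p + 1)"
      unfolding g_def using t by (intro divide_right_mono) auto
    also have "\<dots> \<le> 1 / (2 ^ k) ^ (p + 1)"
      using k t by (intro divide_left_mono power_mono mult_pos_pos zero_less_power) auto
    finally show "\<exists>k. norm t \<le> 2 ^ Suc k \<and> (if 1 \<le> norm t then g t else 0) \<le> 1 / (2 ^ k) ^ (p + 1)"
      using k t by auto
  next
    have "1 / (2 ^ k) ^ (p + 1) * (2 ^ Suc k) ^ p = 2 ^ p * (1 / 2 :: real) ^ k" for k :: nat
      by (simp add: power_mult_distrib field_simps)
    then show "summable (\<lambda>k. 1 / (2 ^ k) ^ (p + 1) * (2 ^ Suc k) ^ DIM(real ^ 'n) :: real)"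
      unfolding p(2) by (simp only: summable_mult summable_geometric norm_divide) (simp add: summable_mult summable_geometric)
  qed auto
  have inner: "(\<integral>\<^sup>+t. ennreal (if norm t < 1 then g t else 0) \<partial>lborel) < \<infinity>"
  proof (rule nn_integral_less_top_of_ball_cover)
    fix t :: "real ^ 'n" assume t: "t \<noteq> 0" and "0 < (if norm t < 1 then g t else 0)"
    then have t1: "norm t < 1" by (simp split: if_splits)
    \<comment> \<open>Inside the unit ball the shells are indexed by the size of
      \<open>1 / norm t\<close>, so the radii shrink as \<open>1 / 2 ^ k\<close>. The bound on
      \<open>g\<close> grows with exponent \<open>p - 1\<close>, one less than that of the
      volume.\<close>
    then obtain k where k: "2 ^ k \<le> 1 / norm t" "1 / norm t \<le> 2 ^ Suc k"
      using ex_dyadic_interval[of "1 / norm t"] t by auto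
    have "norm t ^ (p + 1) = norm t ^ (p - 1) * (norm t)\<^sup>2"
      using p(1) by (simp flip: power_add)
    then have "g t \<le> (1 / norm t) ^ (p - 1)"
      using t unfolding g_def by (simp add: divide_simps)
    also have "\<dots> \<le> (2 ^ Suc k) ^ (p - 1)"
      using k t by (intro power_mono) auto
    finally show "\<exists>k. norm t \<le> 1 / 2 ^ k \<and> (if norm t < 1 then g t else 0) \<le> (2 ^ Suc k) ^ (p - 1)"
      using t1 k t by (intro exI[of _ k]) (auto simp: field_simps)
  next
    obtain q where q: "p = Suc q" using p(1) by (cases p) auto
    have "(2 ^ Suc k) ^ (p - 1) * (1 / 2 ^ k) ^ p = 2 ^ (p - 1) * (1 / 2 :: real) ^ k" for k :: nat
      by (simp add: q power_mult_distrib power_divide field_simps)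
    then show "summable (\<lambda>k. (2 ^ Suc k) ^ (p - 1) * (1 / 2 ^ k) ^ DIM(real ^ 'n) :: real)"
      unfolding p(2) by (simp only: summable_mult summable_geometric norm_divide) (simp add: summable_mult summable_geometric)
  qed auto
  have "(\<integral>\<^sup>+t. ennreal (min 1 ((norm t)\<^sup>2) * w1 (t :: real ^ 'n)) \<partial>lborel)
      = (\<integral>\<^sup>+t. ennreal (1 / K p) * (ennreal (if 1 \<le> norm t then g t else 0)
          + ennreal (if norm t < 1 then g t else 0)) \<partial>lborel)"
    using K_pos[of p]
    by (intro nn_integral_cong)
      (auto simp: w1_def g_def p_def mult_ac simp flip: ennreal_mult')
  also have "\<dots> = ennreal (1 / K p) * ((\<integral>\<^sup>+t. ennreal (if 1 \<le> norm t then g t else 0) \<partial>lborel)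
      + (\<integral>\<^sup>+t. ennreal (if norm t < 1 then g t else 0) \<partial>lborel))"
    unfolding g_def by (subst nn_integral_cmult) (auto intro!: arg_cong2[where f="(*)"] nn_integral_add)
  also have "\<dots> < \<infinity>"
    using outer inner by (simp add: ennreal_mult_less_top)
  finally show ?thesis .
qed

subsection \<open>Empirical characteristic functions\<close>

lemma cmod_iexp_minus_one_le: "cmod (iexp x - 1) \<le> \<bar>x\<bar>"
  using iexp_approx1[of x 0] by simp

text \<open>Passing from the block to the full norms lets one bound on the mean of
  \<open>norm X\<close> control every block at once.\<close>

lemma abs_block_inner_le: "\<bar>block_inner b j t x\<bar> \<le> norm t * norm x"
proof -
  have "\<bar>block_inner b j t x\<bar> \<le> (\<Sum>i\<in>block b j. \<bar>t $ i\<bar> * \<bar>x $ i\<bar>)"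
    unfolding block_inner_def by (rule order_trans[OF sum_abs]) (simp add: abs_mult)
  also have "\<dots> \<le> (\<Sum>i\<in>UNIV. \<bar>t $ i\<bar> * \<bar>x $ i\<bar>)"
    by (intro sum_mono2) auto
  also have "\<dots> \<le> norm t * norm x"
    using L2_set_mult_ineq[of "\<lambda>i. t $ i" "\<lambda>i. x $ i" UNIV]
    by (simp add: norm_vec_def L2_set_def)
  finally show ?thesis .
qed

lemma measurable_block_inner [measurable (raw)]:
  assumes "f \<in> borel_measurable N" "g \<in> borel_measurable N"
  shows "(\<lambda>x. block_inner b j (f x) (g x)) \<in> borel_measurable N"
  unfolding block_inner_def
  by (intro borel_measurable_sum borel_measurable_times
      borel_measurable_continuous_on[OF _ assms(1), of "\<lambda>v. v $ i" for i]
      borel_measurable_continuous_on[OF _ assms(2), of "\<lambda>v. v $ i" for i] continuous_intros)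

lemma average_minus_one_le:
  fixes z :: "nat \<Rightarrow> complex"
  assumes "1 \<le> n" and "(\<Sum>k=1..n. cmod (z k - 1)) \<le> c * real n"
  shows "cmod ((1 / of_nat n) * (\<Sum>k=1..n. z k) - 1) \<le> c"
proof -
  have "(1 / of_nat n) * (\<Sum>k=1..n. z k) - 1 = (1 / of_nat n) * (\<Sum>k=1..n. z k - 1)"
    using assms(1) by (simp add: sum_subtractf field_simps)
  also have "cmod \<dots> = cmod (\<Sum>k=1..n. z k - 1) / real n"
    by (simp add: norm_mult norm_divide)
  also have "\<dots> \<le> c * real n / real n"
    using assms(2) norm_sum[of "\<lambda>k. z k - 1" "{1..n}"] by (intro divide_right_mono) auto
  finally show ?thesis using assms(1) by simp
qed

lemma average_norm_le_1:
  fixes z :: "nat \<Rightarrow> complex"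
  assumes "\<And>k. cmod (z k) \<le> 1"
  shows "cmod ((1 / of_nat n) * (\<Sum>k=1..n. z k)) \<le> 1"
proof -
  have "cmod (\<Sum>k=1..n. z k) \<le> real n"
    using sum_norm_bound[of "{1..n}" z 1] assms by simp
  then show ?thesis by (cases "n = 0") (auto simp: norm_mult norm_divide field_simps)
qed

lemma emp_char_le_1: "cmod (emp_char n x t) \<le> 1"
  unfolding emp_char_def by (rule average_norm_le_1) simp

lemma emp_char_star_le_1: "cmod (emp_char_star b d n x t) \<le> 1"
  unfolding emp_char_star_def by (rule average_norm_le_1) simp

lemma emp_char_prod_le_1: "cmod (emp_char_prod b d n x t) \<le> 1"
  unfolding emp_char_prod_def
  by (rule order_trans[OF norm_prod_le], rule prod_le_1)
    (auto intro!: average_norm_le_1[simplified])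

text \<open>Two distinct indices in \<open>{1..n}\<close> differ by less than \<open>n\<close>, so
  their shifts are not congruent modulo \<open>n\<close> and the cyclic shift permutes
  \<open>{1..n}\<close>. This is why wrapping around does not affect a bound by the mean of the
  norms.\<close>

lemma sum_cyc_eq:
  assumes "1 \<le> n" "1 \<le> j"
  shows "(\<Sum>k=1..n. f (cyc n (k + j - 1))) = (\<Sum>k=1..n. f k)"
proof -
  have inj: "inj_on (\<lambda>k. cyc n (k + j - 1)) {1..n}"
  proof (rule linorder_inj_onI)
    fix k l assume kl: "k < l" "k \<in> {1..n}" "l \<in> {1..n}"
    show "cyc n (k + j - 1) \<noteq> cyc n (l + j - 1)"
    proof
      assume "cyc n (k + j - 1) = cyc n (l + j - 1)"
      then have "(l + j - 1 - 1) mod n = (k + j - 1 - 1) mod n" by (simp add: cyc_def)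
      then have "n dvd (l + j - 1 - 1) - (k + j - 1 - 1)"
        using kl by (subst (asm) mod_eq_dvd_iff_nat) auto
      \<comment> \<open>Since \<open>k\<close>, \<open>l\<close> and \<open>j\<close> are at least
        1, no inner subtraction is truncated.\<close>
      moreover have "(l + j - 1 - 1) - (k + j - 1 - 1) = l - k" using kl assms by auto
      moreover have "0 < l - k" "l - k < n" using kl by auto
      ultimately show False using nat_dvd_not_less by metis
    qed
  qed auto
  have "(\<lambda>k. cyc n (k + j - 1)) ` {1..n} \<subseteq> {1..n}"
    using assms by (auto simp: cyc_def Suc_le_eq)
  then have "(\<lambda>k. cyc n (k + j - 1)) ` {1..n} = {1..n}"
    using endo_inj_surj[OF _ _ inj] by simp
  then show ?thesis using sum.reindex[OF inj, of f] by simp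
qed

text \<open>The sample is deterministic here; \<open>C\<close> will be the random constant bounding
  the sample means, and one such \<open>C\<close> then serves all \<open>n\<close>.\<close>

context
  fixes x :: "nat \<Rightarrow> real ^ 'n::finite" and n :: nat and C :: real
  assumes n: "1 \<le> n" and mean_le: "(\<Sum>k=1..n. norm (x k)) \<le> C * real n"
begin

lemma sum_norm_mult_le: "(\<Sum>k=1..n. norm t * norm (x k)) \<le> (C * norm t) * real n"
  using mult_left_mono[OF mean_le norm_ge_zero[of t]] by (simp add: sum_distrib_left mult_ac)

lemma emp_char_minus_one_le: "cmod (emp_char n x t - 1) \<le> C * norm t"
  unfolding emp_char_def
proof (rule average_minus_one_le[OF n order_trans[OF sum_mono sum_norm_mult_le]])
  show "cmod (iexp (t \<bullet> x k) - 1) \<le> norm t * norm (x k)" for k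
    using cmod_iexp_minus_one_le Cauchy_Schwarz_ineq2 order_trans by blast
qed

text \<open>All factors have modulus at most 1, so replacing them by 1 one after another costs no
  more than the sum of their distances to 1.\<close>

lemma emp_char_prod_minus_one_le: "cmod (emp_char_prod b d n x t - 1) \<le> real d * C * norm t"
proof -
  let ?f = "\<lambda>j. (1 / of_nat n) * (\<Sum>k=1..n. iexp (block_inner b j t (x k)))"
  have "cmod (emp_char_prod b d n x t - 1) = cmod ((\<Prod>j=1..d. ?f j) - (\<Prod>j=1..d. 1))"
    by (simp add: emp_char_prod_def)
  also have "\<dots> \<le> (\<Sum>j=1..d. cmod (?f j - 1))"
    by (rule norm_prod_diff) (rule average_norm_le_1, simp_all)
  also have "\<dots> \<le> (\<Sum>j=1..d. C * norm t)"
  proof (rule sum_mono)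
    fix j
    show "cmod (?f j - 1) \<le> C * norm t"
    proof (rule average_minus_one_le[OF n order_trans[OF sum_mono sum_norm_mult_le]])
      show "cmod (iexp (block_inner b j t (x k)) - 1) \<le> norm t * norm (x k)" for k
        using cmod_iexp_minus_one_le abs_block_inner_le order_trans by blast
    qed
  qed
  finally show ?thesis by simp
qed

text \<open>The exponent is a sum of \<open>d\<close> block products. After exchanging the sums,
  each \<open>j\<close> sees a permuted sample, whose mean norm is that of the original.\<close>

lemma emp_char_star_minus_one_le: "cmod (emp_char_star b d n x t - 1) \<le> real d * C * norm t"
  unfolding emp_char_star_def
proof (rule average_minus_one_le[OF n])
  let ?b = "\<lambda>j k. block_inner b j t (x (cyc n (k + j - 1)))"
  have "(\<Sum>k=1..n. cmod (iexp (\<Sum>j=1..d. ?b j k) - 1)) \<le> (\<Sum>k=1..n. \<Sum>j=1..d. \<bar>?b j k\<bar>)"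
    by (intro sum_mono order_trans[OF cmod_iexp_minus_one_le sum_abs])
  also have "\<dots> \<le> (\<Sum>k=1..n. \<Sum>j=1..d. norm t * norm (x (cyc n (k + j - 1))))"
    by (intro sum_mono abs_block_inner_le)
  also have "\<dots> = (\<Sum>j=1..d. \<Sum>k=1..n. norm t * norm (x (cyc n (k + j - 1))))"
    by (rule sum.swap)
  also have "\<dots> = (\<Sum>j=1..d. \<Sum>k=1..n. norm t * norm (x k))"
    by (intro sum.cong refl sum_cyc_eq[OF n, where f = "\<lambda>i. norm t * norm (x i)"]) simp
  also have "\<dots> \<le> (\<Sum>j=1..d. (C * norm t) * real n)"
    by (intro sum_mono sum_norm_mult_le)
  finally show "(\<Sum>k=1..n. cmod (iexp (\<Sum>j=1..d. ?b j k) - 1)) \<le> real d * C * norm t * real n"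
    by simp
qed

end

text \<open>Only countable quantifiers occur on the right, so the set of convergence becomes
  measurable in the product space, as Fubini's theorem requires.\<close>

lemma LIMSEQ_iff_inverse_Suc:
  fixes F :: "nat \<Rightarrow> 'a :: metric_space"
  shows "F \<longlonglongrightarrow> L \<longleftrightarrow> (\<forall>i. \<exists>N. \<forall>n\<ge>N. dist (F n) L < inverse (real (Suc i)))"
proof
  assume R: "\<forall>i. \<exists>N. \<forall>n\<ge>N. dist (F n) L < inverse (real (Suc i))"
  show "F \<longlonglongrightarrow> L"
  proof (rule metric_LIMSEQ_I)
    fix e :: real assume "0 < e"
    then obtain i where i: "inverse (real (Suc i)) < e" using reals_Archimedean by blast
    from R obtain N where "\<forall>n\<ge>N. dist (F n) L < inverse (real (Suc i))" by blast
    with i show "\<exists>N. \<forall>n\<ge>N. dist (F n) L < e" by (intro exI[of _ N]) force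
  qed
next
  assume L: "F \<longlonglongrightarrow> L"
  show "\<forall>i. \<exists>N. \<forall>n\<ge>N. dist (F n) L < inverse (real (Suc i))"
    by (intro allI metric_LIMSEQ_D[OF L]) simp
qed

text \<open>Sample and argument vary together, so that the same fact serves on the product space and
  for a fixed sample. Only indices from 1 on are constrained, as nothing is known about
  \<open>Xs 0\<close>.\<close>

lemma measurable_emp_char [measurable (raw)]:
  assumes "\<And>k. 1 \<le> k \<Longrightarrow> (\<lambda>x. f x k) \<in> borel_measurable N" and [measurable]: "g \<in> borel_measurable N"
  shows "(\<lambda>x. emp_char n (f x) (g x)) \<in> borel_measurable N"
proof -
  have [measurable]: "(\<lambda>x. f x k) \<in> borel_measurable N" if "k \<in> {1..n}" for k
    using assms(1) that by auto
  show ?thesis unfolding emp_char_def by measurable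
qed

lemma measurable_emp_char_prod [measurable (raw)]:
  assumes "\<And>k. 1 \<le> k \<Longrightarrow> (\<lambda>x. f x k) \<in> borel_measurable N" and [measurable]: "g \<in> borel_measurable N"
  shows "(\<lambda>x. emp_char_prod b d n (f x) (g x)) \<in> borel_measurable N"
proof -
  have [measurable]: "(\<lambda>x. f x k) \<in> borel_measurable N" if "k \<in> {1..n}" for k
    using assms(1) that by auto
  show ?thesis unfolding emp_char_prod_def by measurable
qed

lemma measurable_emp_char_star [measurable (raw)]:
  assumes "\<And>k. 1 \<le> k \<Longrightarrow> (\<lambda>x. f x k) \<in> borel_measurable N" and [measurable]: "g \<in> borel_measurable N"
  shows "(\<lambda>x. emp_char_star b d n (f x) (g x)) \<in> borel_measurable N"
proof -
  \<comment> \<open>\<open>cyc\<close> never returns 0.\<close>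
  have [measurable]: "(\<lambda>x. f x (cyc n k)) \<in> borel_measurable N" for k
    using assms(1) by (simp add: cyc_def)
  show ?thesis unfolding emp_char_star_def by measurable
qed

section \<open>Dominated convergence for the weighted norm\<close>

lemma wnorm2_tendsto:
  fixes \<eta> :: "nat \<Rightarrow> real ^ 'n::finite \<Rightarrow> complex"
  assumes [measurable]: "\<And>n. \<eta> n \<in> borel_measurable borel" "\<eta>' \<in> borel_measurable borel"
    and bounded: "\<And>n t. cmod (\<eta> n t) \<le> 2"
    and lipschitz: "\<And>n t. cmod (\<eta> n t) \<le> L * norm t"
    and lim: "AE t in lborel. (\<lambda>n. \<eta> n t) \<longlonglongrightarrow> \<eta>' t"
  shows "(\<lambda>n. wnorm2 (\<eta> n)) \<longlonglongrightarrow> wnorm2 \<eta>'"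
  unfolding wnorm2_def
proof (rule nn_integral_dominated_convergence)
  let ?w = "\<lambda>t :: real ^ 'n. ennreal (4 + L\<^sup>2) * ennreal (min 1 ((norm t)\<^sup>2) * w1 t)"
  \<comment> \<open>The 4 is the square of the uniform bound 2 and serves outside the unit ball;
    \<open>L\<^sup>2\<close> serves inside.\<close>
  have bound: "(cmod (\<eta> n t))\<^sup>2 \<le> (4 + L\<^sup>2) * min 1 ((norm t)\<^sup>2)" for n t
  proof (cases "(norm t)\<^sup>2 \<le> 1")
    case True
    have "(cmod (\<eta> n t))\<^sup>2 \<le> (L * norm t)\<^sup>2"
      by (intro power_mono lipschitz) simp
    also have "\<dots> \<le> (4 + L\<^sup>2) * (norm t)\<^sup>2"
      by (simp add: power_mult_distrib algebra_simps)
    finally show ?thesis using True by (simp add: min_def)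
  next
    case False
    have "(cmod (\<eta> n t))\<^sup>2 \<le> 2\<^sup>2"
      by (intro power_mono bounded) simp
    also have "\<dots> \<le> 4 + L\<^sup>2" by simp
    finally show ?thesis using False by (simp add: min_def)
  qed
  show "AE t in lborel. ennreal ((cmod (\<eta> n t))\<^sup>2 * w1 t) \<le> ?w t" for n
  proof (rule AE_I2)
    fix t
    have "(cmod (\<eta> n t))\<^sup>2 * w1 t \<le> (4 + L\<^sup>2) * (min 1 ((norm t)\<^sup>2) * w1 t)"
      using mult_right_mono[OF bound w1_nonneg] by (simp add: mult.assoc)
    then have "ennreal ((cmod (\<eta> n t))\<^sup>2 * w1 t) \<le> ennreal ((4 + L\<^sup>2) * (min 1 ((norm t)\<^sup>2) * w1 t))"
      by (rule ennreal_leI)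
    also have "\<dots> = ?w t" by (rule ennreal_mult') simp
    finally show "ennreal ((cmod (\<eta> n t))\<^sup>2 * w1 t) \<le> ?w t" .
  qed
  have "(\<integral>\<^sup>+t. ?w t \<partial>lborel) = ennreal (4 + L\<^sup>2) * (\<integral>\<^sup>+t. ennreal (min 1 ((norm t)\<^sup>2) * w1 (t :: real ^ 'n)) \<partial>lborel)"
    by (rule nn_integral_cmult) measurable
  also have "\<dots> < \<infinity>"
    using nn_integral_min_w1[where 'n='n] by (simp add: ennreal_mult_less_top)
  finally show "(\<integral>\<^sup>+t. ?w t \<partial>lborel) < \<infinity>" .
  show "AE t in lborel. (\<lambda>n. ennreal ((cmod (\<eta> n t))\<^sup>2 * w1 t)) \<longlonglongrightarrow> ennreal ((cmod (\<eta>' t))\<^sup>2 * w1 t)"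
    using lim by eventually_elim (intro tendsto_intros tendsto_ennrealI)
next
  show "(\<lambda>t. ennreal ((cmod (\<eta> n t))\<^sup>2 * w1 t)) \<in> borel_measurable lborel" for n by measurable
next
  show "(\<lambda>t. ennreal ((cmod (\<eta>' t))\<^sup>2 * w1 t)) \<in> borel_measurable lborel" by measurable
next
  show "(\<lambda>t. ennreal (4 + L\<^sup>2) * ennreal (min 1 ((norm t)\<^sup>2) * w1 (t :: real ^ 'n))) \<in> borel_measurable lborel" by measurable
qed

section \<open>Almost sure limits for a sample of random vectors\<close>

locale iid_vector_sample = iid_sample M X Xs
  for M :: "'a measure" and X :: "'a \<Rightarrow> real ^ 'n::finite" and Xs :: "nat \<Rightarrow> 'a \<Rightarrow> real ^ 'n"
begin

lemma AE_emp_char_tendsto: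
  "AE \<omega> in M. (\<lambda>n. emp_char n (\<lambda>k. Xs k \<omega>) t) \<longlonglongrightarrow> char_joint M X t"
  unfolding emp_char_def char_joint_def by (rule strong_law) simp_all

lemma AE_emp_char_prod_tendsto:
  "AE \<omega> in M. (\<lambda>n. emp_char_prod b d n (\<lambda>k. Xs k \<omega>) t) \<longlonglongrightarrow> char_prod b d M X t"
proof -
  have "AE \<omega> in M. \<forall>j\<in>{1..d}. (\<lambda>n. (1 / of_nat n) * (\<Sum>k=1..n. iexp (block_inner b j t (Xs k \<omega>))))
      \<longlonglongrightarrow> (LINT \<omega>|M. iexp (block_inner b j t (X \<omega>)))"
    by (intro AE_finite_allI strong_law) simp_all
  then show ?thesis
    unfolding emp_char_prod_def char_prod_def
    by eventually_elim (intro tendsto_prod, blast)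
qed

lemma AE_emp_char_star_tendsto:
  "AE \<omega> in M. (\<lambda>n. emp_char_star b d n (\<lambda>k. Xs k \<omega>) t) \<longlonglongrightarrow> char_prod b d M X t"
proof -
  let ?W = "\<lambda>k \<omega>. \<Prod>j=1..d. iexp (block_inner b j t (Xs (k + j - 1) \<omega>))"
  have "AE \<omega> in M. (\<lambda>n. (1 / of_nat n) * (\<Sum>k=1..n. ?W k \<omega>)) \<longlonglongrightarrow> char_prod b d M X t"
    unfolding char_prod_def by (rule moving_product_strong_law) simp_all
  then show ?thesis
  proof eventually_elim
    case (elim \<omega>)
    let ?V = "\<lambda>n k. iexp (\<Sum>j=1..d. block_inner b j t (Xs (cyc n (k + j - 1)) \<omega>))"
    have W: "?W k \<omega> = iexp (\<Sum>j=1..d. block_inner b j t (Xs (k + j - 1) \<omega>))" for k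
      by (simp add: sum_distrib_left exp_sum)
    \<comment> \<open>Only the last \<open>d\<close> summands are affected by the cyclic convention.\<close>
    have diff: "norm (emp_char_star b d n (\<lambda>k. Xs k \<omega>) t - (1 / of_nat n) * (\<Sum>k=1..n. ?W k \<omega>))
        \<le> 2 * real d / real n" for n
    proof -
      have "(\<Sum>k=1..n. ?V n k - ?W k \<omega>) = (\<Sum>k\<in>{n-d<..n}. ?V n k - ?W k \<omega>)"
      proof (rule sum.mono_neutral_right)
        show "\<forall>k\<in>{1..n} - {n-d<..n}. ?V n k - ?W k \<omega> = 0"
        proof
          fix k assume k: "k \<in> {1..n} - {n-d<..n}"
          \<comment> \<open>Here \<open>k \<le> n - d\<close>, so \<open>k + j - 1\<close> stays
            below \<open>n\<close> and the reduction is the identity.\<close>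
          have "cyc n (k + j - 1) = k + j - 1" if "j \<in> {1..d}" for j
            using k that by (auto simp: cyc_def)
          then show "?V n k - ?W k \<omega> = 0" unfolding W by simp
        qed
      qed auto
      also have "cmod \<dots> \<le> real (card {n-d<..n}) * 2"
      proof (rule sum_norm_bound)
        fix k
        have "cmod (?V n k - ?W k \<omega>) \<le> cmod (?V n k) + cmod (?W k \<omega>)" by (rule norm_triangle_ineq4)
        also have "\<dots> = 2" unfolding W by simp
        finally show "cmod (?V n k - ?W k \<omega>) \<le> 2" .
      qed
      also have "\<dots> \<le> 2 * real d" by simp
      finally have *: "cmod (\<Sum>k=1..n. ?V n k - ?W k \<omega>) \<le> 2 * real d" .
      have eq: "emp_char_star b d n (\<lambda>k. Xs k \<omega>) t - (1 / of_nat n) * (\<Sum>k=1..n. ?W k \<omega>)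
          = (1 / of_nat n) * (\<Sum>k=1..n. ?V n k - ?W k \<omega>)"
        by (simp add: emp_char_star_def sum_subtractf right_diff_distrib)
      have "norm ((1 / of_nat n) * (\<Sum>k=1..n. ?V n k - ?W k \<omega>))
          = cmod (\<Sum>k=1..n. ?V n k - ?W k \<omega>) / real n"
        by (simp add: norm_mult norm_divide)
      then show ?thesis
        unfolding eq using divide_right_mono[OF * of_nat_0_le_iff] by (rule ord_eq_le_trans)
    qed
    have "(\<lambda>n. emp_char_star b d n (\<lambda>k. Xs k \<omega>) t - (1 / of_nat n) * (\<Sum>k=1..n. ?W k \<omega>)) \<longlonglongrightarrow> 0"
      by (rule Lim_null_comparison[OF always_eventually[OF allI[OF diff]] lim_const_over_n])
    from tendsto_add[OF this elim] show ?case by (simp only: diff_add_cancel add_0)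
  qed
qed

lemma measurable_char_joint [measurable]: "char_joint M X \<in> borel_measurable borel"
  unfolding char_joint_def by measurable

lemma measurable_char_prod [measurable]: "char_prod b d M X \<in> borel_measurable borel"
  unfolding char_prod_def by measurable

text \<open>The null sets belonging to the individual \<open>t\<close> are traded for a single null
  set of outcomes, outside which almost every \<open>t\<close> is good. Joint measurability of
  \<open>F\<close> makes the set of convergence measurable in the product.\<close>

lemma AE_AE_tendsto:
  fixes F :: "nat \<Rightarrow> 'a \<times> (real ^ 'n) \<Rightarrow> complex"
  assumes [measurable]: "\<And>n. F n \<in> borel_measurable (M \<Otimes>\<^sub>M lborel)" "G \<in> borel_measurable borel"
    and lim: "\<And>t. AE \<omega> in M. (\<lambda>n. F n (\<omega>, t)) \<longlonglongrightarrow> G t"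
  shows "AE \<omega> in M. AE t in lborel. (\<lambda>n. F n (\<omega>, t)) \<longlonglongrightarrow> G t"
proof -
  interpret pair_sigma_finite M "lborel :: (real ^ 'n) measure" ..
  have "{x \<in> space (M \<Otimes>\<^sub>M lborel). (\<lambda>n. F n (fst x, snd x)) \<longlonglongrightarrow> G (snd x)} \<in> sets (M \<Otimes>\<^sub>M lborel)"
    unfolding LIMSEQ_iff_inverse_Suc prod.collapse by measurable
  from AE_commute[OF this] lim show ?thesis by simp
qed

lemma measurable_Xs_fst: "1 \<le> k \<Longrightarrow> (\<lambda>p. Xs k (fst p)) \<in> borel_measurable (M \<Otimes>\<^sub>M lborel)"
  by (rule measurable_compose[OF measurable_fst measurable_Xs])

text \<open>\<open>F\<close> stands for either estimator of the product of the marginal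
  characteristic functions, and \<open>c\<close> for its Lipschitz factor relative to the mean norm.
  The premise for \<open>n = 0\<close> is there because every term of the sequence has to be
  dominated, whereas the Lipschitz bound starts at \<open>n = 1\<close>.\<close>

lemma AE_wnorm2_tendsto:
  assumes int: "integrable M (\<lambda>\<omega>. norm (X \<omega>))"
    and meas: "\<And>n. (\<lambda>p. F n (\<lambda>k. Xs k (fst p)) (snd p)) \<in> borel_measurable (M \<Otimes>\<^sub>M lborel)"
    and meas_t: "\<And>n x. F n x \<in> borel_measurable borel"
    and zero: "\<And>x t. F 0 x t = emp_char 0 x t"
    and bounded: "\<And>n x t. cmod (F n x t) \<le> 1"
    and lipschitz: "\<And>n x C t. 1 \<le> n \<Longrightarrow> (\<Sum>k=1..n. norm (x k)) \<le> C * real n \<Longrightarrow> cmod (F n x t - 1) \<le> c * C * norm t"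
    and lim: "\<And>t. AE \<omega> in M. (\<lambda>n. F n (\<lambda>k. Xs k \<omega>) t) \<longlonglongrightarrow> char_prod b d M X t"
  shows "AE \<omega> in M. (\<lambda>n. wnorm2 (\<lambda>t. emp_char n (\<lambda>k. Xs k \<omega>) t - F n (\<lambda>k. Xs k \<omega>) t)) \<longlonglongrightarrow> Q b d M X"
proof -
  let ?\<eta> = "\<lambda>n x t. emp_char n x t - F n x t"
  have "AE \<omega> in M. AE t in lborel. (\<lambda>n. ?\<eta> n (\<lambda>k. Xs k (fst (\<omega>, t))) (snd (\<omega>, t)))
      \<longlonglongrightarrow> char_joint M X t - char_prod b d M X t"
  proof (rule AE_AE_tendsto)
    show "(\<lambda>p. ?\<eta> n (\<lambda>k. Xs k (fst p)) (snd p)) \<in> borel_measurable (M \<Otimes>\<^sub>M lborel)" for n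
      by (intro borel_measurable_diff measurable_emp_char measurable_Xs_fst meas) simp_all
    show "AE \<omega> in M. (\<lambda>n. ?\<eta> n (\<lambda>k. Xs k (fst (\<omega>, t))) (snd (\<omega>, t)))
        \<longlonglongrightarrow> char_joint M X t - char_prod b d M X t" for t
      using AE_emp_char_tendsto lim by eventually_elim (auto intro: tendsto_diff)
  qed measurable
  then show ?thesis
    using AE_bounded_norm_means[OF int]
  proof eventually_elim
    case (elim \<omega>)
    let ?x = "\<lambda>k. Xs k \<omega>"
    from elim(2) obtain C where C: "(\<Sum>k=1..n. norm (?x k)) \<le> C * real n" for n by blast
    show ?case
      unfolding Q_def
    proof (rule wnorm2_tendsto)
      show "cmod (?\<eta> n ?x t) \<le> 2" for n t
        using norm_triangle_ineq4[of "emp_char n ?x t" "F n ?x t"] emp_char_le_1[of n ?x t] bounded[of n ?x t]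
        by linarith
      \<comment> \<open>Both functions are compared with 1, which contributes the summands 1 and
        \<open>c\<close>. The absolute value makes the constant nonnegative, as the case
        \<open>n = 0\<close> demands.\<close>
      show "cmod (?\<eta> n ?x t) \<le> \<bar>(1 + c) * C\<bar> * norm t" for n t
      proof (cases "n = 0")
        case True
        then show ?thesis by (simp add: zero)
      next
        case False
        then have n: "1 \<le> n" by simp
        have "cmod (?\<eta> n ?x t) \<le> cmod (emp_char n ?x t - 1) + cmod (F n ?x t - 1)"
          using norm_triangle_ineq4[of "emp_char n ?x t - 1" "F n ?x t - 1"] by simp
        also have "\<dots> \<le> C * norm t + c * C * norm t"
          by (intro add_mono emp_char_minus_one_le lipschitz n C)
        also have "\<dots> = ((1 + c) * C) * norm t" by (simp add: algebra_simps)
        also have "\<dots> \<le> \<bar>(1 + c) * C\<bar> * norm t" by (intro mult_right_mono) auto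
        finally show ?thesis .
      qed
      show "AE t in lborel. (\<lambda>n. ?\<eta> n ?x t) \<longlonglongrightarrow> char_joint M X t - char_prod b d M X t"
        using elim(1) by simp
      show "?\<eta> n ?x \<in> borel_measurable borel" for n
        by (intro borel_measurable_diff measurable_emp_char meas_t) simp_all
    qed measurable
  qed
qed

end

theorem theorem2:
  fixes M :: "'a measure"
    and X :: "'a \<Rightarrow> real ^ 'n::finite"
    and Xs :: "nat \<Rightarrow> 'a \<Rightarrow> real ^ 'n"
    and b :: "'n \<Rightarrow> nat"
    and d :: nat
  assumes "prob_space M"
    and "d \<ge> 2"
    and "range b = {1..d}"
    and "X \<in> borel_measurable M"
    and "\<And>j. j \<in> {1..d} \<Longrightarrow>
           absolutely_continuous (block_lborel b j)
             (distr M (block_lborel b j) (\<lambda>\<omega>. component b j (X \<omega>)))"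
    and "prob_space.indep_vars M (\<lambda>_. borel) Xs {1..}"
    and "\<And>k. k \<ge> 1 \<Longrightarrow> distr M borel (Xs k) = distr M borel X"
    and "integrable M (\<lambda>\<omega>. norm (X \<omega>))"
  shows "AE \<omega> in M.
           ((\<lambda>n. Q_emp b d n (\<lambda>k. Xs k \<omega>)) \<longlonglongrightarrow> Q b d M X) \<and>
           ((\<lambda>n. Q_star b d n (\<lambda>k. Xs k \<omega>)) \<longlonglongrightarrow> Q b d M X)"
proof -
  interpret prob_space M by fact
  interpret iid_vector_sample M X Xs
    by unfold_locales (use assms in auto)
  have "AE \<omega> in M. (\<lambda>n. Q_emp b d n (\<lambda>k. Xs k \<omega>)) \<longlonglongrightarrow> Q b d M X"
    unfolding Q_emp_def
  proof (rule AE_wnorm2_tendsto)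
    \<comment> \<open>For \<open>n = 0\<close> every factor is 0; the product is nonempty because
      \<open>d \<ge> 2\<close>, hence 0 as well.\<close>
    show "emp_char_prod b d 0 x t = emp_char 0 x t" for x :: "nat \<Rightarrow> real ^ 'n" and t
      using assms(2) by (simp add: emp_char_prod_def emp_char_def prod_zero)
    show "cmod (emp_char_prod b d n x t - 1) \<le> real d * C * norm t"
      if "1 \<le> n" "(\<Sum>k=1..n. norm (x k)) \<le> C * real n" for n x C and t :: "real ^ 'n"
      using that by (rule emp_char_prod_minus_one_le)
    show "(\<lambda>p. emp_char_prod b d n (\<lambda>k. Xs k (fst p)) (snd p)) \<in> borel_measurable (M \<Otimes>\<^sub>M lborel)" for n
      by (intro measurable_emp_char_prod measurable_Xs_fst) simp_all
    show "emp_char_prod b d n x \<in> borel_measurable borel" for n and x :: "nat \<Rightarrow> real ^ 'n"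
      by (intro measurable_emp_char_prod) simp_all
  qed (rule assms(8) emp_char_prod_le_1 AE_emp_char_prod_tendsto)+
  moreover have "AE \<omega> in M. (\<lambda>n. Q_star b d n (\<lambda>k. Xs k \<omega>)) \<longlonglongrightarrow> Q b d M X"
    unfolding Q_star_def
  proof (rule AE_wnorm2_tendsto)
    show "emp_char_star b d 0 x t = emp_char 0 x t" for x :: "nat \<Rightarrow> real ^ 'n" and t
      by (simp add: emp_char_star_def emp_char_def)
    show "cmod (emp_char_star b d n x t - 1) \<le> real d * C * norm t"
      if "1 \<le> n" "(\<Sum>k=1..n. norm (x k)) \<le> C * real n" for n x C and t :: "real ^ 'n"
      using that by (rule emp_char_star_minus_one_le)
    show "(\<lambda>p. emp_char_star b d n (\<lambda>k. Xs k (fst p)) (snd p)) \<in> borel_measurable (M \<Otimes>\<^sub>M lborel)" for n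
      by (intro measurable_emp_char_star measurable_Xs_fst) simp_all
    show "emp_char_star b d n x \<in> borel_measurable borel" for n and x :: "nat \<Rightarrow> real ^ 'n"
      by (intro measurable_emp_char_star) simp_all
  qed (rule assms(8) emp_char_star_le_1 AE_emp_char_star_tendsto)+
  ultimately show ?thesis by eventually_elim simp
qed

end
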